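(* a) Let $0<p<1$. Then the maximal operator $$\widetilde S_p^{*}f:=\sup_{n\in\mathbb N}\frac{|S_nf|}{(n+1)^{1/p-1}}$$ is bounded from the Hardy space $H_p$ to the Lebesgue space $L_p$. b) Let $0<p<1$ and let $\{\Phi_n:n\in\mathbb N\}$ be any non-decreasing sequence of positive numbers satisfying $$\limsup_{n\to\infty}\frac{n^{1/p-1}}{\Phi_n}=+\infty .$$ Then there exists a sequence $\{n_k:k\in\mathbb N\}$ of positive integers such that, with $f_k:=D_{M_{2n_k+1}}-D_{M_{2n_k}}$, $$\sup_{k\in\mathbb N}\frac{\left\|\dfrac{S_{M_{2n_k}+1}f_k}{\Phi_{M_{2n_k}+2}}\right\|_{weak-L_p}}{\|f_k\|_{H_p}}=\infty .$$
   Context: $\mathbb N_+$ is the set of positive integers, $\mathbb N=\mathbb N_+\cup\{0\}$. Fix a bounded sequence $m=(m_0,m_1,\dots)$ of integers $m_k\ge 2$. $G_m=\prod_{k\ge0}Z_{m_k}$, where $Z_{m_k}=\{0,\dots,m_k-1\}$ is the additive group modulo $m_k$, with the product of the discrete topologies; $\mu$ is the Haar measure with $\mu(G_m)=1$. $M_0:=1$, $M_{k+1}:=m_kM_k$; every $n\in\mathbb N$ is uniquely $n=\sum_{j\ge0}n_jM_j$ with $n_j\in Z_{m_j}$. $r_k(x):=\exp(2\pi i x_k/m_k)$, $\psi_n:=\prod_{k\ge0}r_k^{n_k}$ (Vilenkin system), $D_n:=\sum_{k=0}^{n-1}\psi_k$. $I_0(x):=G_m$, $I_n(x):=\{y: y_0=x_0,\dots,y_{n-1}=x_{n-1}\}$;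 $\mathcal F_n$ is the $\sigma$-algebra generated by $\{I_n(x):x\in G_m\}$. For $g\in L_1(G_m)$: $\widehat g(k):=\int g\overline{\psi_k}\,d\mu$, $S_ng:=\sum_{k=0}^{n-1}\widehat g(k)\psi_k$. A martingale is a sequence $f=(f^{(n)}:n\in\mathbb N)$ of integrable functions with $f^{(n)}$ $\mathcal F_n$-measurable and $S_{M_n}f^{(k)}=f^{(n)}$ for $n\le k$; $f^*:=\sup_n|f^{(n)}|$; $H_p$ is the set of martingales with $\|f\|_{H_p}:=\|f^*\|_p<\infty$, where $\|g\|_p:=(\int|g|^pd\mu)^{1/p}$. For a martingale, $\widehat f(i):=\lim_k\int f^{(k)}\overline{\psi_i}\,d\mu$ and $S_nf:=\sum_{k=0}^{n-1}\widehat f(k)\psi_k$. A function $g\in L_1$ is identified with the martingale $(S_{M_n}g:n\in\mathbb N)$, so $\|g\|_{H_p}=\|\sup_n|S_{M_n}g|\|_p$. $\|g\|_{weak-L_p}:=\sup_{\lambda>0}\lambda\,\mu(|g|>\lambda)^{1/p}$. An operator $T$ is bounded from $H_p$ to $X$ if there is a constant $C$ with $\|Tf\|_X\le C\|f\|_{H_p}$ for all $f\in H_p$. *)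

theory Defs
  imports "HOL-Probability.Probability" "HOL-Algebra.Product_Groups"
begin

section \<open>The Vilenkin group and its Haar measure\<close>

text \<open>
  Throughout, \<open>m :: nat \<Rightarrow> nat\<close> is the generating sequence.  The component
  \<open>Z\<^sub>m\<^sub>k\<close> is the library group \<^const>\<open>integer_mod_group\<close>, with carrier \<open>{0..<int (m k)}\<close>.
\<close>

definition vil_group :: "(nat \<Rightarrow> nat) \<Rightarrow> (nat \<Rightarrow> int) monoid" where
  "vil_group m = product_group UNIV (\<lambda>k. integer_mod_group (m k))"

abbreviation vil_points :: "(nat \<Rightarrow> nat) \<Rightarrow> (nat \<Rightarrow> int) set" where
  "vil_points m \<equiv> carrier (vil_group m)"

definition vil_top :: "(nat \<Rightarrow> nat) \<Rightarrow> (nat \<Rightarrow> int) topology" where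
  "vil_top m = product_topology (\<lambda>k. discrete_topology (carrier (integer_mod_group (m k)))) UNIV"

text \<open>
  The library has no general Haar measure.  The normalized Haar measure of the compact group
  \<open>vil_group m\<close> is the product of the normalized counting measures of the factors; the lemma
  \<open>vil_haar_iff\<close> below shows that this product is the only translation invariant
  probability measure on the Borel sets of \<open>vil_top m\<close>.
\<close>

definition vil_haar :: "(nat \<Rightarrow> nat) \<Rightarrow> (nat \<Rightarrow> int) measure" where
  "vil_haar m = (\<Pi>\<^sub>M k\<in>UNIV. uniform_count_measure (carrier (integer_mod_group (m k))))"

primrec vil_M :: "(nat \<Rightarrow> nat) \<Rightarrow> nat \<Rightarrow> nat" where
  "vil_M m 0 = 1"
| "vil_M m (Suc k) = m k * vil_M m k"

text \<open>The set \<open>I\<^sub>n(x)\<close>.\<close>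

definition vil_cyl :: "(nat \<Rightarrow> nat) \<Rightarrow> nat \<Rightarrow> (nat \<Rightarrow> int) \<Rightarrow> (nat \<Rightarrow> int) set" where
  "vil_cyl m n x = {y \<in> vil_points m. \<forall>j<n. y j = x j}"

definition vil_filtration :: "(nat \<Rightarrow> nat) \<Rightarrow> nat \<Rightarrow> (nat \<Rightarrow> int) measure" where
  "vil_filtration m n = sigma (vil_points m) (vil_cyl m n ` vil_points m)"


section \<open>The Vilenkin system and Fourier partial sums\<close>

text \<open>
  \<open>vil_digit m n j\<close> is the digit \<open>n\<^sub>j\<close> of the mixed radix expansion of \<open>n\<close>; see the
  lemmas \<open>vil_digit_expansion\<close> and \<open>vil_digit_unique\<close> below.
\<close>

definition vil_digit :: "(nat \<Rightarrow> nat) \<Rightarrow> nat \<Rightarrow> nat \<Rightarrow> nat" where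
  "vil_digit m n j = (n div vil_M m j) mod m j"

definition vil_r :: "(nat \<Rightarrow> nat) \<Rightarrow> nat \<Rightarrow> (nat \<Rightarrow> int) \<Rightarrow> complex" where
  "vil_r m k x = exp (2 * complex_of_real pi * \<i> * of_int (x k) / of_nat (m k))"

text \<open>Only finitely many digits are nonzero, so the infinite product ranges over a finite set.\<close>

definition vil_psi :: "(nat \<Rightarrow> nat) \<Rightarrow> nat \<Rightarrow> (nat \<Rightarrow> int) \<Rightarrow> complex" where
  "vil_psi m n x = (\<Prod>k\<in>{k. vil_digit m n k \<noteq> 0}. vil_r m k x ^ vil_digit m n k)"

definition vil_D :: "(nat \<Rightarrow> nat) \<Rightarrow> nat \<Rightarrow> (nat \<Rightarrow> int) \<Rightarrow> complex" where
  "vil_D m n x = (\<Sum>k<n. vil_psi m k x)"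

definition vil_coeff :: "(nat \<Rightarrow> nat) \<Rightarrow> ((nat \<Rightarrow> int) \<Rightarrow> complex) \<Rightarrow> nat \<Rightarrow> complex" where
  "vil_coeff m g k = (LINT x|vil_haar m. g x * cnj (vil_psi m k x))"

definition vil_S ::
  "(nat \<Rightarrow> nat) \<Rightarrow> nat \<Rightarrow> ((nat \<Rightarrow> int) \<Rightarrow> complex) \<Rightarrow> (nat \<Rightarrow> int) \<Rightarrow> complex" where
  "vil_S m n g x = (\<Sum>k<n. vil_coeff m g k * vil_psi m k x)"


section \<open>Martingales\<close>

text \<open>
  The atoms of \<open>vil_filtration m n\<close> have positive measure, so for the \<open>f n\<close> below equality
  almost everywhere and equality at every point coincide.
\<close>

definition vil_martingale :: "(nat \<Rightarrow> nat) \<Rightarrow> (nat \<Rightarrow> (nat \<Rightarrow> int) \<Rightarrow> complex) \<Rightarrow> bool" where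
  "vil_martingale m f \<longleftrightarrow>
     (\<forall>n. integrable (vil_haar m) (f n) \<and> f n \<in> borel_measurable (vil_filtration m n)) \<and>
     (\<forall>k. \<forall>n\<le>k. \<forall>x\<in>vil_points m. vil_S m (vil_M m n) (f k) x = f n x)"

definition mart_coeff ::
  "(nat \<Rightarrow> nat) \<Rightarrow> (nat \<Rightarrow> (nat \<Rightarrow> int) \<Rightarrow> complex) \<Rightarrow> nat \<Rightarrow> complex" where
  "mart_coeff m f i = lim (\<lambda>k. vil_coeff m (f k) i)"

definition mart_S ::
  "(nat \<Rightarrow> nat) \<Rightarrow> nat \<Rightarrow> (nat \<Rightarrow> (nat \<Rightarrow> int) \<Rightarrow> complex) \<Rightarrow> (nat \<Rightarrow> int) \<Rightarrow> complex" where
  "mart_S m n f x = (\<Sum>k<n. mart_coeff m f k * vil_psi m k x)"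

text \<open>The martingale with which an integrable function is identified.\<close>

definition mart_of ::
  "(nat \<Rightarrow> nat) \<Rightarrow> ((nat \<Rightarrow> int) \<Rightarrow> complex) \<Rightarrow> nat \<Rightarrow> (nat \<Rightarrow> int) \<Rightarrow> complex" where
  "mart_of m g n = vil_S m (vil_M m n) g"

definition mart_max :: "(nat \<Rightarrow> (nat \<Rightarrow> int) \<Rightarrow> complex) \<Rightarrow> (nat \<Rightarrow> int) \<Rightarrow> ennreal" where
  "mart_max f x = (SUP n. ennreal (norm (f n x)))"


section \<open>Norms and boundedness\<close>

text \<open>Maximal functions may take the value \<open>\<infinity>\<close>, hence powers (with exponent \<open>a > 0\<close>) and
  \<open>L\<^sub>p\<close>-norms for \<open>ennreal\<close>-valued functions.\<close>

definition enn_powr :: "ennreal \<Rightarrow> real \<Rightarrow> ennreal" where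
  "enn_powr t a = (if t = \<infinity> then \<infinity> else ennreal (enn2real t powr a))"

definition Lp_norm :: "(nat \<Rightarrow> nat) \<Rightarrow> real \<Rightarrow> ((nat \<Rightarrow> int) \<Rightarrow> ennreal) \<Rightarrow> ennreal" where
  "Lp_norm m p g = enn_powr (\<integral>\<^sup>+x. enn_powr (g x) p \<partial>vil_haar m) (1 / p)"

definition weak_Lp_norm :: "(nat \<Rightarrow> nat) \<Rightarrow> real \<Rightarrow> ((nat \<Rightarrow> int) \<Rightarrow> complex) \<Rightarrow> ennreal" where
  "weak_Lp_norm m p g =
     (SUP l\<in>{0<..}. ennreal (l * measure (vil_haar m) {x \<in> vil_points m. l < norm (g x)} powr (1 / p)))"

definition Hp_norm :: "(nat \<Rightarrow> nat) \<Rightarrow> real \<Rightarrow> (nat \<Rightarrow> (nat \<Rightarrow> int) \<Rightarrow> complex) \<Rightarrow> ennreal" where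
  "Hp_norm m p f = Lp_norm m p (mart_max f)"

definition Hp_space :: "(nat \<Rightarrow> nat) \<Rightarrow> real \<Rightarrow> (nat \<Rightarrow> (nat \<Rightarrow> int) \<Rightarrow> complex) set" where
  "Hp_space m p = {f. vil_martingale m f \<and> Hp_norm m p f < \<infinity>}"

definition bounded_Hp_Lp ::
  "(nat \<Rightarrow> nat) \<Rightarrow> real \<Rightarrow> ((nat \<Rightarrow> (nat \<Rightarrow> int) \<Rightarrow> complex) \<Rightarrow> (nat \<Rightarrow> int) \<Rightarrow> ennreal) \<Rightarrow> bool" where
  "bounded_Hp_Lp m p T \<longleftrightarrow>
     (\<exists>C::real. \<forall>f\<in>Hp_space m p. Lp_norm m p (T f) \<le> ennreal C * Hp_norm m p f)"

definition weighted_max_S ::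
  "(nat \<Rightarrow> nat) \<Rightarrow> real \<Rightarrow> (nat \<Rightarrow> (nat \<Rightarrow> int) \<Rightarrow> complex) \<Rightarrow> (nat \<Rightarrow> int) \<Rightarrow> ennreal" where
  "weighted_max_S m p f x =
     (SUP n. ennreal (norm (mart_S m n f x) / real (n + 1) powr (1 / p - 1)))"


section \<open>Adequacy of the definitions\<close>

lemma vil_M_ge: "(\<And>k. 2 \<le> m k) \<Longrightarrow> 2 ^ n \<le> vil_M m n"
  by (induction n) (auto intro: mult_le_mono)

lemma vil_M_pos: "(\<And>k. 2 \<le> m k) \<Longrightarrow> 0 < vil_M m n"
  by (rule less_le_trans[OF _ vil_M_ge]) auto

lemma vil_digit_mod: "n mod vil_M m N = (\<Sum>j<N. vil_digit m n j * vil_M m j)"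
proof (induction N)
  case (Suc N)
  have "n mod vil_M m (Suc N) = n mod (vil_M m N * m N)"
    by (simp add: mult.commute)
  also have "\<dots> = vil_M m N * (n div vil_M m N mod m N) + n mod vil_M m N"
    by (rule mod_mult2_eq)
  finally show ?case
    using Suc by (simp add: vil_digit_def mult.commute)
qed simp

lemma vil_digit_expansion:
  assumes "\<And>k. 2 \<le> m k"
  shows "n = (\<Sum>j\<in>{j. vil_digit m n j \<noteq> 0}. vil_digit m n j * vil_M m j)"
    and "finite {j. vil_digit m n j \<noteq> 0}" and "vil_digit m n j < m j"
proof -
  have less: "n < vil_M m j" if "n \<le> j" for j
    using that less_exp[of j] vil_M_ge[of m j] assms by (meson le_less_trans less_le_trans)
  have sub: "{j. vil_digit m n j \<noteq> 0} \<subseteq> {..<n}"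
  proof (rule subsetI, rule ccontr)
    fix j assume "j \<in> {j. vil_digit m n j \<noteq> 0}" "j \<notin> {..<n}"
    with less[of j] show False by (simp add: vil_digit_def)
  qed
  show "finite {j. vil_digit m n j \<noteq> 0}"
    using sub by (rule finite_subset) simp
  have "(\<Sum>j\<in>{j. vil_digit m n j \<noteq> 0}. vil_digit m n j * vil_M m j) = (\<Sum>j<n. vil_digit m n j * vil_M m j)"
    by (rule sum.mono_neutral_left) (use sub in auto)
  then show "n = (\<Sum>j\<in>{j. vil_digit m n j \<noteq> 0}. vil_digit m n j * vil_M m j)"
    using vil_digit_mod[of n m n] less[of n] by simp
  show "vil_digit m n j < m j"
    using assms[of j] by (simp add: vil_digit_def)
qed

lemma vil_digit_unique:
  assumes "\<And>k. 2 \<le> m k" "\<And>j. d j < m j" "k < N"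
  shows "vil_digit m (\<Sum>j<N. d j * vil_M m j) k = d k"
  using assms(3)
proof (induction N)
  case (Suc N)
  have lt: "(\<Sum>j<K. d j * vil_M m j) < vil_M m K" for K
  proof (induction K)
    case (Suc K)
    have "Suc (d K) * vil_M m K \<le> m K * vil_M m K"
      using assms(2)[of K] by (intro mult_le_mono1) simp
    with Suc show ?case by simp
  qed simp
  show ?case
  proof (cases "k = N")
    case True
    then show ?thesis
      using lt[of N] assms(2)[of N] vil_M_pos[of m N, OF assms(1)] by (simp add: vil_digit_def)
  next
    case False
    with Suc have k: "k < N" by simp
    from k have "Suc k \<le> N" by simp
    then have "vil_M m (Suc k) dvd vil_M m N"
      by (induction N rule: dec_induct) auto
    then obtain c where "vil_M m N = vil_M m (Suc k) * c" ..
    then have c: "vil_M m N = vil_M m k * (m k * c)" by simp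
    have eq: "(\<Sum>j<Suc N. d j * vil_M m j) = (\<Sum>j<N. d j * vil_M m j) + vil_M m k * (m k * (c * d N))"
      unfolding sum.lessThan_Suc c by (simp only: ac_simps)
    show ?thesis
      unfolding vil_digit_def eq
      using Suc.IH[OF k] vil_M_pos[of m k, OF assms(1)] by (simp add: vil_digit_def)
  qed
qed simp

lemma vil_points_iff: "(\<And>k. 2 \<le> m k) \<Longrightarrow> x \<in> vil_points m \<longleftrightarrow> (\<forall>k. 0 \<le> x k \<and> x k < int (m k))"
proof -
  assume a: "\<And>k. 2 \<le> m k"
  have "m k \<noteq> 0" for k using a[of k] by auto
  then show ?thesis
    by (auto simp: vil_group_def PiE_iff carrier_integer_mod_group)
qed

lemma vil_mult: "x \<otimes>\<^bsub>vil_group m\<^esub> y = (\<lambda>k. (x k + y k) mod int (m k))"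
  by (auto simp: vil_group_def)

lemma space_vil_haar: "space (vil_haar m) = vil_points m"
  by (simp add: vil_haar_def vil_group_def space_PiM space_uniform_count_measure)

lemma topspace_vil_top: "topspace (vil_top m) = vil_points m"
  by (simp add: vil_top_def vil_group_def)

lemma vil_cyl_self: "x \<in> vil_points m \<Longrightarrow> x \<in> vil_cyl m n x"
  by (simp add: vil_cyl_def)

lemma vil_cyl_eq: "y \<in> vil_cyl m n x \<Longrightarrow> vil_cyl m n y = vil_cyl m n x"
  by (auto simp: vil_cyl_def)

lemma vil_cyl_mono: "n \<le> k \<Longrightarrow> vil_cyl m k x \<subseteq> vil_cyl m n x"
  by (auto simp: vil_cyl_def)

lemma finite_vil_cyls:
  assumes "\<And>k. 2 \<le> m k"
  shows "finite (vil_cyl m n ` vil_points m)"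
proof -
  have "vil_cyl m n ` vil_points m \<subseteq> vil_cyl m n ` (\<Pi>\<^sub>E k\<in>{..<n}. {0..<int (m k)})"
  proof
    fix C assume "C \<in> vil_cyl m n ` vil_points m"
    then obtain x where x: "x \<in> vil_points m" "C = vil_cyl m n x" by auto
    have "vil_cyl m n x = vil_cyl m n (restrict x {..<n})"
      by (auto simp: vil_cyl_def)
    moreover have "restrict x {..<n} \<in> (\<Pi>\<^sub>E k\<in>{..<n}. {0..<int (m k)})"
      using x vil_points_iff[of m x] assms by (auto simp: PiE_iff)
    ultimately show "C \<in> vil_cyl m n ` (\<Pi>\<^sub>E k\<in>{..<n}. {0..<int (m k)})"
      using x by blast
  qed
  then show ?thesis
    by (rule finite_subset) (intro finite_imageI finite_PiE; simp)
qed

definition vil_cyls :: "(nat \<Rightarrow> nat) \<Rightarrow> (nat \<Rightarrow> int) set set" where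
  "vil_cyls m = (\<Union>n. vil_cyl m n ` vil_points m)"

lemma vil_cyls_sub: "vil_cyls m \<subseteq> Pow (vil_points m)"
  by (auto simp: vil_cyls_def vil_cyl_def)

lemma countable_vil_cyls:
  assumes "\<And>k. 2 \<le> m k"
  shows "countable (vil_cyls m)"
  unfolding vil_cyls_def
  by (rule countable_UN[OF _ countable_finite[OF finite_vil_cyls]]) (use assms in simp_all)

lemma openin_vil_cyl: "x \<in> vil_points m \<Longrightarrow> openin (vil_top m) (vil_cyl m n x)"
proof -
  assume x: "x \<in> vil_points m"
  define X where "X = (\<lambda>k. if k < n then {x k} else carrier (integer_mod_group (m k)))"
  have "finite {k. X k \<noteq> carrier (integer_mod_group (m k))}"
    by (rule finite_subset[of _ "{..<n}"]) (auto simp: X_def)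
  then have "openin (vil_top m) (\<Pi>\<^sub>E k\<in>UNIV. X k)"
    unfolding vil_top_def using x
    by (subst openin_PiE_gen) (auto simp: X_def vil_group_def)
  moreover have "(\<Pi>\<^sub>E k\<in>UNIV. X k) = vil_cyl m n x"
    using x by (auto simp: X_def vil_cyl_def vil_group_def PiE_iff split: if_splits)
  ultimately show ?thesis by simp
qed

lemma openin_vil_top_cyl:
  assumes "openin (vil_top m) U" "x \<in> U"
  obtains n where "vil_cyl m n x \<subseteq> U"
proof -
  obtain X where X: "finite {k. X k \<noteq> carrier (integer_mod_group (m k))}" "x \<in> Pi\<^sub>E UNIV X" "Pi\<^sub>E UNIV X \<subseteq> U"
    using assms unfolding vil_top_def openin_product_topology_alt by force
  obtain n where n: "{k. X k \<noteq> carrier (integer_mod_group (m k))} \<subseteq> {..<n}"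
    using X(1) by (metis finite_nat_iff_bounded)
  have "vil_cyl m n x \<subseteq> Pi\<^sub>E UNIV X"
  proof
    fix y assume y: "y \<in> vil_cyl m n x"
    have "y k \<in> X k" for k
    proof (cases "k < n")
      case True
      then show ?thesis using y X(2) by (auto simp: vil_cyl_def PiE_iff)
    next
      case False
      then have "X k = carrier (integer_mod_group (m k))" using n by auto
      then show ?thesis using y by (auto simp: vil_cyl_def vil_group_def PiE_iff)
    qed
    then show "y \<in> Pi\<^sub>E UNIV X" by auto
  qed
  then show ?thesis using X(3) by (intro that[of n]) (rule subset_trans)
qed

lemma vil_Borel_cyls:
  assumes "\<And>k. 2 \<le> m k"
  shows "sigma_sets (vil_points m) {U. openin (vil_top m) U} = sigma_sets (vil_points m) (vil_cyls m)"
proof (rule antisym; rule sigma_sets_mono; rule subsetI)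
  fix U assume "U \<in> {U. openin (vil_top m) U}"
  then have U: "openin (vil_top m) U" by simp
  have sub: "U \<subseteq> vil_points m" using openin_subset[OF U] topspace_vil_top by metis
  have "U = \<Union> {C \<in> vil_cyls m. C \<subseteq> U}"
  proof (rule antisym; rule subsetI)
    fix x assume x: "x \<in> U"
    then obtain n where "vil_cyl m n x \<subseteq> U" using openin_vil_top_cyl[OF U] by blast
    moreover have "x \<in> vil_points m" using sub x by blast
    moreover have "x \<in> vil_cyl m n x" by (rule vil_cyl_self) fact
    moreover have "vil_cyl m n x \<in> vil_cyls m" unfolding vil_cyls_def using \<open>x \<in> vil_points m\<close> by blast
    ultimately show "x \<in> \<Union> {C \<in> vil_cyls m. C \<subseteq> U}" by blast
  qed auto
  moreover have "\<Union> {C \<in> vil_cyls m. C \<subseteq> U} \<in> sigma_sets (vil_points m) (vil_cyls m)"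
    by (rule sigma_sets_UNION[OF countable_subset[OF _ countable_vil_cyls[OF assms]]])
        (auto intro: sigma_sets.Basic)
  ultimately show "U \<in> sigma_sets (vil_points m) (vil_cyls m)" by simp
next
  fix C assume "C \<in> vil_cyls m"
  then show "C \<in> sigma_sets (vil_points m) {U. openin (vil_top m) U}"
    by (auto simp: vil_cyls_def intro!: sigma_sets.Basic openin_vil_cyl)
qed

lemma vil_cyl_prod_emb:
  assumes "x \<in> vil_points m"
  shows "vil_cyl m n x = prod_emb UNIV (\<lambda>k. uniform_count_measure (carrier (integer_mod_group (m k)))) {..<n}
           (\<Pi>\<^sub>E k\<in>{..<n}. {x k})"
  using assms
  by (auto simp: vil_cyl_def vil_group_def prod_emb_def PiE_iff space_uniform_count_measure)

lemma sets_vil_haar_cyls: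
  assumes "\<And>k. 2 \<le> m k"
  shows "sets (vil_haar m) = sigma_sets (vil_points m) (vil_cyls m)"
proof
  have PE: "(\<Pi>\<^sub>E k\<in>UNIV. space (uniform_count_measure (carrier (integer_mod_group (m k))))) = vil_points m"
    by (simp add: vil_group_def space_uniform_count_measure)
  show "sets (vil_haar m) \<subseteq> sigma_sets (vil_points m) (vil_cyls m)"
    unfolding vil_haar_def sets_PiM_single PE
  proof (rule sigma_sets_mono, safe)
    fix i A
    define B where "B = {f \<in> vil_points m. f i \<in> A}"
    have "B = \<Union> {C \<in> vil_cyls m. C \<subseteq> B}"
    proof (rule antisym; rule subsetI)
      fix x assume x: "x \<in> B"
      have "vil_cyl m (Suc i) x \<subseteq> B" using x by (auto simp: B_def vil_cyl_def)
      moreover have "x \<in> vil_cyl m (Suc i) x" "x \<in> vil_points m" using x by (auto simp: B_def vil_cyl_def)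
      moreover have "vil_cyl m (Suc i) x \<in> vil_cyls m" unfolding vil_cyls_def using \<open>x \<in> vil_points m\<close> by blast
      ultimately show "x \<in> \<Union> {C \<in> vil_cyls m. C \<subseteq> B}" by blast
    qed auto
    moreover have "\<Union> {C \<in> vil_cyls m. C \<subseteq> B} \<in> sigma_sets (vil_points m) (vil_cyls m)"
      by (rule sigma_sets_UNION[OF countable_subset[OF _ countable_vil_cyls[OF assms]]])
        (auto intro: sigma_sets.Basic)
    ultimately show "{f \<in> vil_points m. f i \<in> A} \<in> sigma_sets (vil_points m) (vil_cyls m)"
      by (simp add: B_def)
  qed
  have "vil_cyl m n x \<in> sets (vil_haar m)" if "x \<in> vil_points m" for n x
    unfolding vil_cyl_prod_emb[OF that] vil_haar_def using that
    by (intro sets_PiM_I) (auto simp: sets_uniform_count_measure vil_group_def)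
  then have "vil_cyls m \<subseteq> sets (vil_haar m)" by (auto simp: vil_cyls_def)
  then show "sigma_sets (vil_points m) (vil_cyls m) \<subseteq> sets (vil_haar m)"
    by (metis sets.sigma_sets_subset space_vil_haar)
qed

lemma sets_vil_haar:
  assumes "\<And>k. 2 \<le> m k"
  shows "sets (vil_haar m) = sigma_sets (topspace (vil_top m)) {U. openin (vil_top m) U}"
  using sets_vil_haar_cyls[OF assms] vil_Borel_cyls[OF assms] by (simp add: topspace_vil_top)

lemma finite_carrier_mod: "(\<And>k. 2 \<le> m k) \<Longrightarrow> carrier (integer_mod_group (m k)) = {0..<int (m k)}"
  by (metis carrier_integer_mod_group not_numeral_le_zero)

lemma prob_factor:
  assumes "\<And>k. 2 \<le> m k"
  shows "prob_space (uniform_count_measure (carrier (integer_mod_group (m k))))"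
proof (rule prob_space_uniform_count_measure)
  have "m k > 0" using assms[of k] by simp
  then show "finite (carrier (integer_mod_group (m k)))" "carrier (integer_mod_group (m k)) \<noteq> {}"
    using finite_carrier_mod[of m k] assms by auto
qed

lemma prob_space_vil_haar:
  assumes "\<And>k. 2 \<le> m k"
  shows "prob_space (vil_haar m)"
  unfolding vil_haar_def by (rule prob_space_PiM) (rule prob_factor[OF assms])

lemma emeasure_vil_cyl:
  assumes "\<And>k. 2 \<le> m k" "x \<in> vil_points m"
  shows "emeasure (vil_haar m) (vil_cyl m n x) = ennreal (1 / real (vil_M m n))"
proof -
  have "emeasure (vil_haar m) (vil_cyl m n x)
      = (\<Prod>k<n. emeasure (uniform_count_measure (carrier (integer_mod_group (m k)))) {x k})"
    unfolding vil_cyl_prod_emb[OF assms(2)] vil_haar_def using assms(2)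
    by (intro emeasure_PiM_emb prob_factor assms) (auto simp: sets_uniform_count_measure vil_group_def)
  also have "\<dots> = (\<Prod>k<n. ennreal (1 / real (m k)))"
  proof (rule prod.cong)
    fix k
    have "x k \<in> carrier (integer_mod_group (m k))" using assms(2) by (auto simp: vil_group_def)
    then show "emeasure (uniform_count_measure (carrier (integer_mod_group (m k)))) {x k} = ennreal (1 / real (m k))"
      using finite_carrier_mod[of m k] assms(1) by (subst emeasure_uniform_count_measure) auto
  qed simp
  also have "\<dots> = ennreal (1 / real (vil_M m n))"
    by (induction n) (auto simp: ennreal_mult'[symmetric])
  finally show ?thesis .
qed

lemma measure_eq_vil_haar:
  assumes m: "\<And>k. 2 \<le> m k" and N: "sets N = sets (vil_haar m)"
    and eq: "\<And>n x. x \<in> vil_points m \<Longrightarrow> emeasure N (vil_cyl m n x) = emeasure (vil_haar m) (vil_cyl m n x)"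
  shows "N = vil_haar m"
proof -
  have zero: "(\<lambda>_. 0) \<in> vil_points m"
    by (simp add: vil_group_def PiE_iff)
  have top: "vil_points m = vil_cyl m 0 (\<lambda>_. 0)" by (auto simp: vil_cyl_def)
  show ?thesis
  proof (rule measure_eqI_generator_eq)
    let ?E = "insert {} (vil_cyls m)"
    have ss: "sigma_sets (vil_points m) ?E = sigma_sets (vil_points m) (vil_cyls m)"
      by (rule antisym; rule sigma_sets_mono) (auto intro: sigma_sets.Empty)
    show "Int_stable ?E"
    proof (rule Int_stableI)
      fix a b assume ab: "a \<in> ?E" "b \<in> ?E"
      show "a \<inter> b \<in> ?E"
      proof (cases "a \<inter> b = {}")
        case False
        then obtain z where z: "z \<in> a" "z \<in> b" by auto
        from ab z obtain k x l y where xy: "a = vil_cyl m k x" "b = vil_cyl m l y"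
          by (auto simp: vil_cyls_def)
        have zp: "z \<in> vil_points m" using z xy by (auto simp: vil_cyl_def)
        have "a = vil_cyl m k z" "b = vil_cyl m l z" using xy z vil_cyl_eq by metis+
        then have "a \<inter> b = vil_cyl m (max k l) z" by (auto simp: vil_cyl_def less_max_iff_disj)
        then show ?thesis using zp by (auto simp: vil_cyls_def)
      qed simp
    qed
    show "?E \<subseteq> Pow (vil_points m)" using vil_cyls_sub by auto
    show "\<And>X. X \<in> ?E \<Longrightarrow> emeasure N X = emeasure (vil_haar m) X"
      using eq by (auto simp: vil_cyls_def)
    show "sets N = sigma_sets (vil_points m) ?E" "sets (vil_haar m) = sigma_sets (vil_points m) ?E"
      using N sets_vil_haar_cyls[OF m] ss by auto
    show "range (\<lambda>i::nat. vil_points m) \<subseteq> ?E" using top zero by (auto simp: vil_cyls_def)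
    show "(\<Union>i::nat. vil_points m) = vil_points m" by simp
    show "\<And>i::nat. emeasure N (vil_points m) \<noteq> \<infinity>"
      using eq[OF zero, of 0] emeasure_vil_cyl[OF m zero, of 0] top by simp
  qed
qed

lemma vil_group_group: "group (vil_group m)"
  by (simp add: vil_group_def)

lemma vil_translate_cyl:
  assumes m: "\<And>k. 2 \<le> m k" and x: "x \<in> vil_points m" and y: "y \<in> vil_points m"
  shows "(\<lambda>z. x \<otimes>\<^bsub>vil_group m\<^esub> z) -` vil_cyl m n (x \<otimes>\<^bsub>vil_group m\<^esub> y) \<inter> vil_points m = vil_cyl m n y"
proof -
  have "(x j + z j) mod int (m j) = (x j + y j) mod int (m j) \<longleftrightarrow> z j = y j" if "z \<in> vil_points m" for z j
  proof
    assume a: "(x j + z j) mod int (m j) = (x j + y j) mod int (m j)"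
    then have "(x j + z j - x j) mod int (m j) = (x j + y j - x j) mod int (m j)"
      by (rule mod_diff_cong) simp
    then have "z j mod int (m j) = y j mod int (m j)"
      by simp
    then show "z j = y j"
      using that y vil_points_iff[of m] m by simp
  qed simp
  moreover have "x \<otimes>\<^bsub>vil_group m\<^esub> z \<in> vil_points m" if "z \<in> vil_points m" for z
    using group.is_monoid[OF vil_group_group[of m]] x that by (intro monoid.m_closed)
  ultimately show ?thesis by (auto simp: vil_cyl_def) (auto simp: vil_mult)
qed

lemma vil_translate_measurable:
  assumes m: "\<And>k. 2 \<le> m k" and x: "x \<in> vil_points m"
  shows "(\<lambda>z. x \<otimes>\<^bsub>vil_group m\<^esub> z) \<in> vil_haar m \<rightarrow>\<^sub>M vil_haar m"
proof (rule measurable_sigma_sets[OF sets_vil_haar_cyls[OF m] vil_cyls_sub])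
  interpret group "vil_group m" by (rule vil_group_group)
  show "(\<lambda>z. x \<otimes>\<^bsub>vil_group m\<^esub> z) \<in> space (vil_haar m) \<rightarrow> vil_points m"
    using x by (auto simp: space_vil_haar)
  fix C assume "C \<in> vil_cyls m"
  then obtain n w where w: "w \<in> vil_points m" "C = vil_cyl m n w" by (auto simp: vil_cyls_def)
  have "w = x \<otimes>\<^bsub>vil_group m\<^esub> (inv\<^bsub>vil_group m\<^esub> x \<otimes>\<^bsub>vil_group m\<^esub> w)"
    using x w by (simp add: m_assoc[symmetric])
  then have "(\<lambda>z. x \<otimes>\<^bsub>vil_group m\<^esub> z) -` C \<inter> space (vil_haar m)
      = vil_cyl m n (inv\<^bsub>vil_group m\<^esub> x \<otimes>\<^bsub>vil_group m\<^esub> w)"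
    using vil_translate_cyl[OF m x, of "inv\<^bsub>vil_group m\<^esub> x \<otimes>\<^bsub>vil_group m\<^esub> w" n] x w
    by (simp add: space_vil_haar)
  then show "(\<lambda>z. x \<otimes>\<^bsub>vil_group m\<^esub> z) -` C \<inter> space (vil_haar m) \<in> sets (vil_haar m)"
    using x w sets_vil_haar_cyls[OF m] by (auto simp: vil_cyls_def intro!: sigma_sets.Basic)
qed

lemma vil_haar_translate:
  assumes m: "\<And>k. 2 \<le> m k" and x: "x \<in> vil_points m"
  shows "distr (vil_haar m) (vil_haar m) (\<lambda>z. x \<otimes>\<^bsub>vil_group m\<^esub> z) = vil_haar m"
proof (rule measure_eq_vil_haar[OF m])
  interpret group "vil_group m" by (rule vil_group_group)
  fix n w assume w: "w \<in> vil_points m"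
  define v where "v = inv\<^bsub>vil_group m\<^esub> x \<otimes>\<^bsub>vil_group m\<^esub> w"
  have v: "v \<in> vil_points m" "w = x \<otimes>\<^bsub>vil_group m\<^esub> v"
    using x w by (auto simp: v_def m_assoc[symmetric])
  have "vil_cyl m n w \<in> sets (vil_haar m)"
    using w sets_vil_haar_cyls[OF m] by (auto simp: vil_cyls_def intro!: sigma_sets.Basic)
  then have "emeasure (distr (vil_haar m) (vil_haar m) (\<lambda>z. x \<otimes>\<^bsub>vil_group m\<^esub> z)) (vil_cyl m n w)
      = emeasure (vil_haar m) (vil_cyl m n v)"
    using vil_translate_cyl[OF m x v(1), of n] v(2)
    by (simp add: emeasure_distr[OF vil_translate_measurable[OF m x]] space_vil_haar)
  then show "emeasure (distr (vil_haar m) (vil_haar m) (\<lambda>z. x \<otimes>\<^bsub>vil_group m\<^esub> z)) (vil_cyl m n w)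
      = emeasure (vil_haar m) (vil_cyl m n w)"
    using emeasure_vil_cyl[OF m v(1)] emeasure_vil_cyl[OF m w] by simp
qed simp

lemma vil_haar_iff:
  assumes m: "\<And>k. 2 \<le> m k"
  shows "N = vil_haar m \<longleftrightarrow>
    sets N = sigma_sets (topspace (vil_top m)) {U. openin (vil_top m) U} \<and> emeasure N (vil_points m) = 1 \<and>
    (\<forall>x\<in>vil_points m. distr N N (\<lambda>z. x \<otimes>\<^bsub>vil_group m\<^esub> z) = N)" (is "_ \<longleftrightarrow> ?R")
proof
  assume "N = vil_haar m"
  then show ?R
    using sets_vil_haar[of m] vil_haar_translate[of m] m prob_space.emeasure_space_1[OF prob_space_vil_haar[of m]]
    by (simp add: space_vil_haar)
next
  assume R: ?R
  interpret group "vil_group m" by (rule vil_group_group)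
  have sN: "sets N = sets (vil_haar m)" using R sets_vil_haar[OF m] by simp
  then have spN: "space N = vil_points m" by (metis sets_eq_imp_space_eq space_vil_haar)
  have cs: "vil_cyl m n w \<in> sets N" if "w \<in> vil_points m" for n w
    using that sN sets_vil_haar_cyls[OF m] by (auto simp: vil_cyls_def intro!: sigma_sets.Basic)
  have zero: "\<one>\<^bsub>vil_group m\<^esub> \<in> vil_points m" by simp
  have const: "emeasure N (vil_cyl m n w) = emeasure N (vil_cyl m n \<one>\<^bsub>vil_group m\<^esub>)"
    if w: "w \<in> vil_points m" for n w
  proof -
    have meas: "(\<lambda>z. w \<otimes>\<^bsub>vil_group m\<^esub> z) \<in> N \<rightarrow>\<^sub>M N"
      using vil_translate_measurable[OF m w] measurable_cong_sets[OF sN sN] by simp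
    have "emeasure N (vil_cyl m n w) = emeasure (distr N N (\<lambda>z. w \<otimes>\<^bsub>vil_group m\<^esub> z)) (vil_cyl m n w)"
      using R w by simp
    also have "\<dots> = emeasure N (vil_cyl m n \<one>\<^bsub>vil_group m\<^esub>)"
      using vil_translate_cyl[OF m w zero, of n] w cs[OF w] spN by (simp add: emeasure_distr[OF meas])
    finally show ?thesis .
  qed
  have part: "(\<Sum>C\<in>vil_cyl m n ` vil_points m. emeasure K C) = emeasure K (vil_points m)"
    if K: "sets K = sets (vil_haar m)" for K n
  proof -
    have "disjoint_family_on (\<lambda>C. C) (vil_cyl m n ` vil_points m)"
      unfolding disjoint_family_on_def using vil_cyl_eq by blast
    then have "(\<Sum>C\<in>vil_cyl m n ` vil_points m. emeasure K C) = emeasure K (\<Union>C\<in>vil_cyl m n ` vil_points m. C)"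
      using cs K sN by (intro sum_emeasure finite_vil_cyls m) auto
    also have "(\<Union>C\<in>vil_cyl m n ` vil_points m. C) = vil_points m"
      by (auto simp: vil_cyl_def)
    finally show ?thesis .
  qed
  show "N = vil_haar m"
  proof (rule measure_eq_vil_haar[OF m sN])
    fix n w assume w: "w \<in> vil_points m"
    let ?c = "card (vil_cyl m n ` vil_points m)"
    have "(\<Sum>C\<in>vil_cyl m n ` vil_points m. emeasure N C)
        = (\<Sum>C\<in>vil_cyl m n ` vil_points m. emeasure N (vil_cyl m n \<one>\<^bsub>vil_group m\<^esub>))"
      by (rule sum.cong) (use const in blast)+
    also have "\<dots> = of_nat ?c * emeasure N (vil_cyl m n \<one>\<^bsub>vil_group m\<^esub>)"
      by (rule sum_constant)
    finally have 1: "of_nat ?c * emeasure N (vil_cyl m n w) = 1"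
      using part[OF sN, of n] R const[OF w] by simp
    have "(\<Sum>C\<in>vil_cyl m n ` vil_points m. emeasure (vil_haar m) C)
        = (\<Sum>C\<in>vil_cyl m n ` vil_points m. ennreal (1 / real (vil_M m n)))"
      by (rule sum.cong) (auto intro: emeasure_vil_cyl m)
    also have "\<dots> = of_nat ?c * ennreal (1 / real (vil_M m n))"
      by (rule sum_constant)
    finally have 2: "of_nat ?c * emeasure (vil_haar m) (vil_cyl m n w) = 1"
      using part[OF refl, of n] emeasure_vil_cyl[OF m w] prob_space.emeasure_space_1[OF prob_space_vil_haar[OF m]]
      by (simp add: space_vil_haar)
    have "?c \<noteq> 0" using 1 by (intro notI) simp
    then have "of_nat ?c \<noteq> (0::ennreal)" "of_nat ?c \<noteq> (\<infinity>::ennreal)" by auto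
    then show "emeasure N (vil_cyl m n w) = emeasure (vil_haar m) (vil_cyl m n w)"
      using 1 2 by (metis ennreal_mult_cancel_left infinity_ennreal_def)
  qed
qed

end

theory Submission
  imports Defs
begin

text \<open>
  Part a) needs no atomic decomposition.  If \<open>n \<le> M\<^sub>N\<close> then \<open>S\<^sub>n f(x)\<close> is the integral of
  \<open>f\<^sup>N(t) K\<^sub>n(x,t)\<close>, where \<open>K\<^sub>n(x,t) = \<Sum>k<n. \<psi>\<^sub>k(x) cnj (\<psi>\<^sub>k(t))\<close> satisfies
  \<open>|K\<^sub>n(x,t)| \<le> M\<^sub>s\<^sub>+\<^sub>1\<close> when \<open>x\<close> and \<open>t\<close> first differ at \<open>s\<close>.  The integrand is constant on
  cylinders of measure \<open>1/M\<^sub>N\<close>, so the \<open>p\<close>-th power of its integral is at most \<open>M\<^sub>N\<close> to the power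
  \<open>1 - p\<close> times the integral of its \<open>p\<close>-th power; the weight absorbs this factor.  What remains is
  a bound of the \<open>p\<close>-th power of the weighted maximal operator at \<open>x\<close> by a multiple of
  \<open>\<Sum>j. M\<^sub>j\<^sup>p \<integral> (f\<^sup>*)\<^sup>p\<close>, integrals over \<open>I\<^sub>j(x)\<close>, and integrating in \<open>x\<close> turns the weights into the
  convergent series of the \<open>M\<^sub>j\<^sup>p\<^sup>-\<^sup>1\<close>.

  In part b) the partial sum of \<open>f\<^sub>k\<close> is a single character, of modulus one, whereas \<open>f\<^sub>k\<close> is its
  own maximal function, is bounded by \<open>M\<^sub>2\<^sub>n\<^sub>+\<^sub>1\<close> and lives on a cylinder of measure \<open>1/M\<^sub>2\<^sub>n\<close>.
\<close>

section \<open>Extended powers and integrability\<close>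

lemma enn_powr_ennreal: "0 \<le> t \<Longrightarrow> enn_powr (ennreal t) a = ennreal (t powr a)"
  by (simp add: enn_powr_def)

lemma enn_powr_0 [simp]: "enn_powr 0 a = 0"
  by (simp add: enn_powr_def)

lemma enn_powr_top [simp]: "enn_powr Orderings.top a = Orderings.top"
  by (simp add: enn_powr_def)

lemma enn_powr_mono: "0 < a \<Longrightarrow> s \<le> t \<Longrightarrow> enn_powr s a \<le> enn_powr t a"
  by (cases s; cases t) (auto simp: enn_powr_ennreal top_unique intro!: ennreal_leI powr_mono2)

lemma enn_powr_mult: "0 < a \<Longrightarrow> enn_powr (s * t) a = enn_powr s a * enn_powr t a"
proof (cases s; cases t)
  fix r r' assume "0 < a" "0 \<le> r" "s = ennreal r" "0 \<le> r'" "t = ennreal r'"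
  then show ?thesis by (simp add: enn_powr_ennreal powr_mult flip: ennreal_mult)
next
  fix r assume a: "0 < a" "0 \<le> r" "s = ennreal r" "t = Orderings.top"
  \<comment> \<open>If \<open>r = 0\<close>, both sides vanish because \<open>0\<close> times
    \<open>\<infinity>\<close> is \<open>0\<close> in \<open>ennreal\<close>.\<close>
  then show ?thesis by (cases "r = 0") (auto simp: enn_powr_ennreal ennreal_mult_top)
next
  fix r assume a: "0 < a" "0 \<le> r" "s = Orderings.top" "t = ennreal r"
  then show ?thesis by (cases "r = 0") (auto simp: enn_powr_ennreal ennreal_top_mult)
qed simp

lemma enn_powr_powr_inverse: "0 < a \<Longrightarrow> enn_powr (enn_powr t (1 / a)) a = t"
  by (cases t) (auto simp: enn_powr_ennreal powr_powr)

lemma enn_powr_inverse_powr: "0 < a \<Longrightarrow> enn_powr (enn_powr t a) (1 / a) = t"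
  by (cases t) (auto simp: enn_powr_ennreal powr_powr)

text \<open>Taking roots turns the bounds on the powers into one bound on all \<open>g i\<close>,
  which passes to the supremum; continuity of \<open>enn_powr\<close> never enters.\<close>

lemma enn_powr_SUP_le:
  assumes "0 < a" "\<And>i. i \<in> I \<Longrightarrow> enn_powr (g i) a \<le> z"
  shows "enn_powr (SUP i\<in>I. g i) a \<le> z"
proof -
  have "g i \<le> enn_powr z (1 / a)" if "i \<in> I" for i
    using enn_powr_mono[OF _ assms(2)[OF that], of "1 / a"] assms(1) by (simp add: enn_powr_inverse_powr)
  then have "(SUP i\<in>I. g i) \<le> enn_powr z (1 / a)" by (rule SUP_least)
  from enn_powr_mono[OF assms(1) this] show ?thesis by (simp add: enn_powr_powr_inverse assms(1))
qed

lemma enn_powr_measurable [measurable]: "(\<lambda>t. enn_powr t a) \<in> borel_measurable borel"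
  unfolding enn_powr_def by measurable

text \<open>Includes the values \<open>0\<close> and \<open>\<infinity>\<close>, so an upper bound
  for a Hardy norm gives a lower bound for a quotient by it with no case distinction.\<close>

lemma ennreal_inverse_antimono: "a \<le> b \<Longrightarrow> inverse b \<le> inverse (a :: ennreal)"
  by (simp add: less_eq_ennreal.rep_eq inverse_ennreal.rep_eq ereal_inverse_antimono)

lemma integrable_mult_bounded:
  fixes g b :: "'a \<Rightarrow> complex"
  assumes "integrable M g" "b \<in> borel_measurable M" "\<And>x. norm (b x) \<le> c"
  shows "integrable M (\<lambda>x. g x * b x)"
proof (rule Bochner_Integration.integrable_bound)
  show "integrable M (\<lambda>x. norm (g x) * c)" using assms(1) by simp
  show "(\<lambda>x. g x * b x) \<in> borel_measurable M" using assms by measurable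
  show "AE x in M. norm (g x * b x) \<le> norm (norm (g x) * c)"
  proof (rule AE_I2)
    fix x
    have "norm (b x) \<le> \<bar>c\<bar>" using assms(3)[of x] by linarith
    then show "norm (g x * b x) \<le> norm (norm (g x) * c)"
      by (simp add: norm_mult abs_mult mult_left_mono)
  qed
qed

section \<open>Characters and kernels\<close>

text \<open>The Dirichlet kernel \<open>vil_D m n\<close> at the group difference of
  \<open>x\<close> and \<open>t\<close>, kept in two variables so that no inverses occur.\<close>

definition vil_kernel :: "(nat \<Rightarrow> nat) \<Rightarrow> nat \<Rightarrow> (nat \<Rightarrow> int) \<Rightarrow> (nat \<Rightarrow> int) \<Rightarrow> complex" where
  "vil_kernel m n x t = (\<Sum>k<n. vil_psi m k x * cnj (vil_psi m k t))"

lemma norm_vil_r [simp]: "norm (vil_r m k x) = 1"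
proof -
  have "vil_r m k x = cis (2 * pi * of_int (x k) / of_nat (m k))"
    by (simp add: vil_r_def cis_conv_exp mult_ac)
  then show ?thesis by simp
qed

lemma norm_vil_psi [simp]: "norm (vil_psi m n x) = 1"
  by (simp add: vil_psi_def prod_norm[symmetric] norm_power)

lemma exp_root_eq_1_iff:
  assumes "0 < n"
  shows "exp (2 * of_real pi * \<i> * of_int d / of_nat n) = 1 \<longleftrightarrow> int n dvd d"
proof -
  have "exp (2 * of_real pi * \<i> * of_int d / of_nat n) = 1 \<longleftrightarrow>
      (\<exists>k::int. 2 * pi * of_int d / of_nat n = of_int (2 * k) * pi)"
    by (subst exp_eq_1) (simp add: Im_divide_of_nat)
  also have "\<dots> \<longleftrightarrow> (\<exists>k::int. of_int d = (of_int (int n * k) :: real))"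
    using assms by (intro ex_cong1) (simp add: field_simps)
  also have "\<dots> \<longleftrightarrow> int n dvd d" unfolding of_int_eq_iff by auto
  finally show ?thesis .
qed

lemma vil_M_dvd: "i \<le> j \<Longrightarrow> vil_M m i dvd vil_M m j"
  by (induction j rule: dec_induct) auto

locale vilenkin =
  fixes m :: "nat \<Rightarrow> nat"
  assumes m2: "2 \<le> m k"
begin

lemma m_pos [simp]: "0 < m k"
  using m2[of k] by linarith

lemma vil_M_positive [simp]: "0 < vil_M m n"
  by (rule vil_M_pos) (rule m2)

lemma vil_M_mono: "i \<le> j \<Longrightarrow> vil_M m i \<le> vil_M m j"
  by (rule dvd_imp_le[OF vil_M_dvd vil_M_positive])

section \<open>Digits of multiples and sums, and the characters they determine\<close>

lemma vil_digit_eq_0: "n < vil_M m s \<Longrightarrow> s \<le> j \<Longrightarrow> vil_digit m n j = 0"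
  using vil_M_mono[of s j] by (simp add: vil_digit_def)

lemma vil_digit_unit: "a < m s \<Longrightarrow> vil_digit m (a * vil_M m s) j = (if j = s then a else 0)"
proof (cases j s rule: linorder_cases)
  case less
  then have "vil_M m (Suc j) dvd vil_M m s" by (intro vil_M_dvd) simp
  then obtain c where "vil_M m s = vil_M m (Suc j) * c" ..
  then have *: "a * vil_M m s = vil_M m j * (m j * (c * a))" by (simp add: ac_simps)
  show ?thesis unfolding vil_digit_def * using less vil_M_positive[of j] by simp
next
  case equal
  then show "a < m s \<Longrightarrow> ?thesis" by (simp add: vil_digit_def)
next
  case greater
  assume "a < m s"
  then have "a * vil_M m s < vil_M m (Suc s)" by simp
  then show ?thesis using greater vil_digit_eq_0[of _ "Suc s" j] by simp
qed

text \<open>No carry occurs: \<open>k\<close> occupies positions below \<open>s\<close>, and a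
  multiple of \<open>M\<^sub>s\<close> only positions from \<open>s\<close> on.\<close>

lemma vil_digit_add:
  assumes "k < vil_M m s"
  shows "vil_digit m (q * vil_M m s + k) j = vil_digit m (q * vil_M m s) j + vil_digit m k j"
proof (cases "j < s")
  case True
  then have "vil_M m (Suc j) dvd vil_M m s" by (intro vil_M_dvd) simp
  then obtain c where "vil_M m s = vil_M m (Suc j) * c" ..
  then have *: "q * vil_M m s = vil_M m j * (m j * (c * q))" by (simp add: ac_simps)
  show ?thesis unfolding vil_digit_def * using vil_M_positive[of j] by simp
next
  case False
  then have "vil_M m s dvd vil_M m j" by (intro vil_M_dvd) simp
  then obtain c where "vil_M m j = vil_M m s * c" ..
  then show ?thesis using assms vil_digit_eq_0[OF assms, of j] False
    by (simp add: vil_digit_def div_mult2_eq)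
qed

text \<open>Lets characters with different digit supports be written over one common index
  set.\<close>

lemma vil_psi_prod:
  assumes "finite A" "{k. vil_digit m n k \<noteq> 0} \<subseteq> A"
  shows "vil_psi m n x = (\<Prod>k\<in>A. vil_r m k x ^ vil_digit m n k)"
  unfolding vil_psi_def by (rule prod.mono_neutral_left) (use assms in auto)

lemma finite_vil_digits: "finite {k. vil_digit m n k \<noteq> 0}"
  by (rule vil_digit_expansion(2)[of m, OF m2])

lemma vil_psi_add:
  assumes "k < vil_M m s"
  shows "vil_psi m (q * vil_M m s + k) x = vil_psi m (q * vil_M m s) x * vil_psi m k x"
proof -
  let ?A = "{j. vil_digit m (q * vil_M m s) j \<noteq> 0} \<union> {j. vil_digit m k j \<noteq> 0}"
  have A: "finite ?A" using finite_vil_digits by blast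
  show ?thesis
    by (subst (1 2 3) vil_psi_prod[OF A])
      (auto simp: vil_digit_add[OF assms] power_add prod.distrib)
qed

lemma vil_psi_unit:
  assumes "a < m s"
  shows "vil_psi m (a * vil_M m s) x = vil_r m s x ^ a"
  by (subst vil_psi_prod[of "{s}"]) (use assms in \<open>auto simp: vil_digit_unit split: if_splits\<close>)

text \<open>The digits of \<open>n\<close> vanish from position \<open>s\<close> on, so only the
  first \<open>s\<close> coordinates enter.\<close>

lemma vil_psi_cong:
  assumes "n < vil_M m s" "\<And>j. j < s \<Longrightarrow> x j = y j"
  shows "vil_psi m n x = vil_psi m n y"
  unfolding vil_psi_def
proof (rule prod.cong)
  fix k assume "k \<in> {k. vil_digit m n k \<noteq> 0}"
  then have "k < s" using vil_digit_eq_0[OF assms(1)] by (meson mem_Collect_eq not_le)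
  then show "vil_r m k x ^ vil_digit m n k = vil_r m k y ^ vil_digit m n k"
    using assms(2) by (simp add: vil_r_def)
qed simp

text \<open>The high digits are constant on the block and contribute a common factor of modulus
  one.\<close>

lemma vil_kernel_block:
  "(\<Sum>k\<in>{q * vil_M m s ..< q * vil_M m s + vil_M m s}. vil_psi m k x * cnj (vil_psi m k t)) =
     vil_psi m (q * vil_M m s) x * cnj (vil_psi m (q * vil_M m s) t) * vil_kernel m (vil_M m s) x t"
proof -
  have "(\<Sum>k\<in>{q * vil_M m s ..< q * vil_M m s + vil_M m s}. vil_psi m k x * cnj (vil_psi m k t)) =
    (\<Sum>k<vil_M m s. vil_psi m (q * vil_M m s + k) x * cnj (vil_psi m (q * vil_M m s + k) t))"
    using sum.shift_bounds_nat_ivl[of "\<lambda>k. vil_psi m k x * cnj (vil_psi m k t)" 0 "q * vil_M m s" "vil_M m s"]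
    by (simp add: atLeast0LessThan add_ac)
  also have "\<dots> = (\<Sum>k<vil_M m s. vil_psi m (q * vil_M m s) x * cnj (vil_psi m (q * vil_M m s) t) *
      (vil_psi m k x * cnj (vil_psi m k t)))"
    by (rule sum.cong) (auto simp: vil_psi_add)
  finally show ?thesis by (simp add: vil_kernel_def sum_distrib_left)
qed

text \<open>Grouping the indices by their digit at position \<open>s\<close> produces a geometric
  sum.\<close>

lemma vil_kernel_Suc:
  "vil_kernel m (vil_M m (Suc s)) x t =
     (\<Sum>a<m s. (vil_r m s x * cnj (vil_r m s t)) ^ a) * vil_kernel m (vil_M m s) x t"
proof -
  have "vil_kernel m (vil_M m (Suc s)) x t =
      (\<Sum>a<m s. \<Sum>k\<in>{a * vil_M m s ..< a * vil_M m s + vil_M m s}. vil_psi m k x * cnj (vil_psi m k t))"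
    by (simp add: vil_kernel_def sum.nat_group)
  also have "\<dots> = (\<Sum>a<m s. (vil_r m s x * cnj (vil_r m s t)) ^ a * vil_kernel m (vil_M m s) x t)"
    by (rule sum.cong) (simp_all add: vil_kernel_block vil_psi_unit power_mult_distrib)
  finally show ?thesis by (simp add: sum_distrib_right)
qed

lemma vil_r_ratio:
  "vil_r m s x * cnj (vil_r m s t) = exp (2 * of_real pi * \<i> * of_int (x s - t s) / of_nat (m s))"
  by (simp add: vil_r_def exp_cnj mult_exp_exp diff_divide_distrib algebra_simps)

lemma vil_r_ratio_eq_1_iff:
  assumes "x \<in> vil_points m" "t \<in> vil_points m"
  shows "vil_r m s x * cnj (vil_r m s t) = 1 \<longleftrightarrow> x s = t s"
proof -
  have *: "0 \<le> x s" "x s < int (m s)" "0 \<le> t s" "t s < int (m s)"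
    using assms vil_points_iff[of m] m2 by auto
  have "int (m s) dvd x s - t s \<longleftrightarrow> x s mod int (m s) = t s mod int (m s)"
    by (simp add: mod_eq_dvd_iff)
  then show ?thesis using * unfolding vil_r_ratio exp_root_eq_1_iff[OF m_pos] by simp
qed

text \<open>The ratio is an \<open>m s\<close>-th root of unity, and it is \<open>1\<close> only if
  the coordinates agree.\<close>

lemma vil_r_ratio_sum:
  assumes "x \<in> vil_points m" "t \<in> vil_points m"
  shows "(\<Sum>a<m s. (vil_r m s x * cnj (vil_r m s t)) ^ a) = (if x s = t s then of_nat (m s) else 0)"
proof (cases "x s = t s")
  case True
  then show ?thesis using vil_r_ratio_eq_1_iff[OF assms, of s] by simp
next
  case False
  have "(vil_r m s x * cnj (vil_r m s t)) ^ m s = exp (of_nat (m s) * (2 * of_real pi * \<i> * of_int (x s - t s) / of_nat (m s)))"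
    unfolding vil_r_ratio by (rule exp_of_nat_mult[symmetric])
  also have "\<dots> = exp (2 * of_real pi * \<i> * of_int (x s - t s))" by simp
  also have "\<dots> = 1" by (subst exp_eq_1) (auto intro!: exI[of _ "x s - t s"])
  finally show ?thesis
    using False vil_r_ratio_eq_1_iff[OF assms, of s] by (subst geometric_sum) auto
qed

text \<open>By \<open>vil_kernel_Suc\<close> the kernel is a product over \<open>s < n\<close> of
  factors \<open>m s\<close> or \<open>0\<close>, the latter as soon as \<open>x\<close> and
  \<open>t\<close> differ at \<open>s\<close>.\<close>

lemma vil_kernel_M:
  assumes "x \<in> vil_points m" "t \<in> vil_points m"
  shows "vil_kernel m (vil_M m n) x t = (if t \<in> vil_cyl m n x then of_nat (vil_M m n) else 0)"
proof (induction n)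
  case 0
  have "vil_psi m 0 y = 1" for y by (simp add: vil_psi_def vil_digit_def)
  then show ?case using assms by (simp add: vil_kernel_def vil_cyl_def)
next
  case (Suc n)
  show ?case
    unfolding vil_kernel_Suc vil_r_ratio_sum[OF assms] Suc
    using assms by (auto simp: vil_cyl_def less_Suc_eq)
qed

lemma norm_vil_kernel_le: "norm (vil_kernel m n x t) \<le> real n"
  unfolding vil_kernel_def by (rule order_trans[OF norm_sum]) (simp add: norm_mult)

text \<open>If \<open>x\<close> and \<open>t\<close> first differ at \<open>s\<close>, the complete blocks of length
  \<open>vil_M m (Suc s)\<close> cancel and only an incomplete block of the sum survives.\<close>

lemma norm_vil_kernel_cyl:
  assumes x: "x \<in> vil_points m" and t: "t \<in> vil_points m" and n: "n \<le> vil_M m (Suc N)"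
  obtains s where "t \<in> vil_cyl m s x" "norm (vil_kernel m n x t) \<le> real (vil_M m (Suc s))"
proof (cases "t \<in> vil_cyl m N x")
  case True
  \<comment> \<open>Here \<open>s = N\<close> works with the trivial bound \<open>n\<close>; this
    includes \<open>t = x\<close>, where there is no first difference.\<close>
  show ?thesis
    by (rule that[OF True], rule order_trans[OF norm_vil_kernel_le]) (use n in \<open>simp only: of_nat_le_iff\<close>)
next
  case False
  then obtain j where "t j \<noteq> x j" using t by (auto simp: vil_cyl_def)
  define s where "s = (LEAST j. t j \<noteq> x j)"
  have s: "t s \<noteq> x s" unfolding s_def by (rule LeastI) fact
  have less: "t j = x j" if "j < s" for j using not_less_Least that unfolding s_def by blast
  define L where "L = vil_M m (Suc s)"
  define q where "q = n div L"
  have "t \<notin> vil_cyl m (Suc s) x" using s by (auto simp: vil_cyl_def)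
  then have zero: "vil_kernel m L x t = 0"
    unfolding L_def by (simp add: vil_kernel_M[OF x t] del: vil_M.simps)
  have split: "{..<n} = {..<q * L} \<union> {q * L..<n}" "{..<q * L} \<inter> {q * L..<n} = {}"
    by (auto simp: q_def) (metis div_times_less_eq_dividend not_le order_trans order_less_le_trans)
  have "(\<Sum>k<q * L. vil_psi m k x * cnj (vil_psi m k t)) =
      (\<Sum>a<q. \<Sum>k\<in>{a * L ..< a * L + L}. vil_psi m k x * cnj (vil_psi m k t))"
    by (simp add: sum.nat_group)
  also have "\<dots> = 0" unfolding L_def vil_kernel_block using zero by (simp add: L_def)
  finally have "vil_kernel m n x t = (\<Sum>k\<in>{q * L..<n}. vil_psi m k x * cnj (vil_psi m k t))"
    unfolding vil_kernel_def split(1) by (subst sum.union_disjoint) (use split in auto)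
  then have "norm (vil_kernel m n x t) \<le> (\<Sum>k\<in>{q * L..<n}. norm (vil_psi m k x * cnj (vil_psi m k t)))"
    by (simp only: norm_sum)
  also have "\<dots> = real (n - q * L)" by (simp add: norm_mult)
  also have "n - q * L = n mod L" by (simp add: q_def minus_div_mult_eq_mod)
  also have "\<dots> \<le> L" by (simp add: L_def less_imp_le)
  finally show ?thesis using t less by (intro that[of s]) (auto simp: vil_cyl_def L_def)
qed

lemma vil_kernel_cong:
  assumes "n \<le> vil_M m s" "\<And>j. j < s \<Longrightarrow> t j = u j"
  shows "vil_kernel m n x t = vil_kernel m n x u"
  unfolding vil_kernel_def
  by (rule sum.cong) (use assms vil_psi_cong[of _ s t u] in auto)

section \<open>Orthogonality and Fourier coefficients of martingales\<close>

lemma vil_cyl_sets [measurable]: "x \<in> vil_points m \<Longrightarrow> vil_cyl m n x \<in> sets (vil_haar m)"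
  using sets_vil_haar_cyls[of m, OF m2] by (auto simp: vil_cyls_def)

lemma vil_r_measurable [measurable]: "vil_r m k \<in> borel_measurable (vil_haar m)"
proof -
  let ?U = "uniform_count_measure (carrier (integer_mod_group (m k)))"
  have "(\<lambda>x. x k) \<in> measurable (vil_haar m) ?U"
    unfolding vil_haar_def by (rule measurable_component_singleton) simp
  \<comment> \<open>Every function on a factor is measurable, since all subsets of the factor
    are.\<close>
  moreover have "(\<lambda>i. exp (2 * complex_of_real pi * \<i> * of_int i / of_nat (m k))) \<in> borel_measurable ?U"
    by (simp add: measurable_def sets_uniform_count_measure space_uniform_count_measure)
  ultimately show ?thesis
    unfolding vil_r_def[abs_def] by (rule measurable_compose)
qed

lemma vil_psi_measurable [measurable]: "vil_psi m n \<in> borel_measurable (vil_haar m)"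
  unfolding vil_psi_def[abs_def] by measurable

lemma cnj_vil_psi_measurable [measurable]: "(\<lambda>x. cnj (vil_psi m n x)) \<in> borel_measurable (vil_haar m)"
  by (rule measurable_compose[OF vil_psi_measurable borel_measurable_continuous_onI])
    (intro continuous_intros)

lemma vil_kernel_measurable [measurable]: "vil_kernel m n x \<in> borel_measurable (vil_haar m)"
  unfolding vil_kernel_def[abs_def] by measurable

lemma integrable_vil_psi_mult:
  "integrable (vil_haar m) g \<Longrightarrow> integrable (vil_haar m) (\<lambda>x. g x * cnj (vil_psi m n x))"
  by (rule integrable_mult_bounded[where c = 1]) auto

lemma integrable_vil_psi: "integrable (vil_haar m) (vil_psi m n)"
proof -
  interpret prob_space "vil_haar m" by (rule prob_space_vil_haar) (rule m2)
  show ?thesis by (rule integrable_const_bound[where B = 1]) auto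
qed

text \<open>Reducing the coordinate sum modulo \<open>m k\<close> changes the exponent by a multiple
  of \<open>2 * pi * \<i>\<close>.\<close>

lemma vil_r_mult: "vil_r m k (x \<otimes>\<^bsub>vil_group m\<^esub> y) = vil_r m k x * vil_r m k y"
proof -
  have "int (m k) * ((x k + y k) div int (m k)) + (x k + y k) mod int (m k) = x k + y k"
    by (rule mult_div_mod_eq)
  then have "x k + y k - (x k + y k) mod int (m k) = int (m k) * ((x k + y k) div int (m k))" by linarith
  then have d: "int (m k) dvd (x k + y k) - (x k + y k) mod int (m k)" by simp
  have "vil_r m k x * vil_r m k y = exp (2 * of_real pi * \<i> * of_int (x k + y k) / of_nat (m k))"
    by (simp add: vil_r_def mult_exp_exp add_divide_distrib algebra_simps)
  also have "\<dots> = exp (2 * of_real pi * \<i> * of_int ((x k + y k) mod int (m k)) / of_nat (m k)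
       + 2 * of_real pi * \<i> * of_int ((x k + y k) - (x k + y k) mod int (m k)) / of_nat (m k))"
    by (simp add: diff_divide_distrib algebra_simps)
  also have "\<dots> = exp (2 * of_real pi * \<i> * of_int ((x k + y k) mod int (m k)) / of_nat (m k))"
    unfolding exp_add exp_root_eq_1_iff[OF m_pos, THEN iffD2, OF d] by simp
  finally show ?thesis by (simp add: vil_r_def vil_mult)
qed

lemma vil_psi_mult: "vil_psi m n (x \<otimes>\<^bsub>vil_group m\<^esub> y) = vil_psi m n x * vil_psi m n y"
  by (simp add: vil_psi_def vil_r_mult power_mult_distrib prod.distrib)

text \<open>Translation by the unit vector at a position where the digits of \<open>j\<close> and \<open>k\<close>
  differ multiplies the integral by a nontrivial root of unity.\<close>

lemma vil_psi_orthonormal: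
  "(LINT x|vil_haar m. vil_psi m j x * cnj (vil_psi m k x)) = (if j = k then 1 else 0)"
proof (cases "j = k")
  case True
  interpret prob_space "vil_haar m" by (rule prob_space_vil_haar) (rule m2)
  have "vil_psi m k x * cnj (vil_psi m k x) = 1" for x
    by (simp add: complex_norm_square[symmetric])
  then show ?thesis using True prob_space by simp
next
  case False
  have "\<exists>s. vil_digit m j s \<noteq> vil_digit m k s"
  proof (rule ccontr)
    assume "\<not> ?thesis"
    then have "vil_digit m j = vil_digit m k" by auto
    then have "j = k" using vil_digit_expansion(1)[of m j, OF m2] vil_digit_expansion(1)[of m k, OF m2] by simp
    then show False using False by simp
  qed
  then obtain s where s: "vil_digit m j s \<noteq> vil_digit m k s" ..
  define e :: "nat \<Rightarrow> int" where "e = (\<lambda>i. if i = s then 1 else 0)"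
  have e: "e \<in> vil_points m"
  proof -
    have "e i < int (m i)" for i using m2[of i] by (auto simp: e_def)
    then show ?thesis using vil_points_iff[of m e] m2 by (auto simp: e_def)
  qed
  have psi_e: "vil_psi m n e = exp (2 * of_real pi * \<i> * of_nat (vil_digit m n s) / of_nat (m s))" for n
  proof -
    \<comment> \<open>Position \<open>s\<close> is inserted because the digit there may be zero; at
      all other positions \<open>e\<close> is \<open>0\<close> and the factor is
      \<open>1\<close>.\<close>
    have "vil_psi m n e = (\<Prod>i\<in>insert s {i. vil_digit m n i \<noteq> 0}. vil_r m i e ^ vil_digit m n i)"
      by (rule vil_psi_prod) (use finite_vil_digits in auto)
    also have "\<dots> = (\<Prod>i\<in>{s}. vil_r m i e ^ vil_digit m n i)"
      by (rule prod.mono_neutral_right) (use finite_vil_digits in \<open>auto simp: vil_r_def e_def\<close>)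
    also have "\<dots> = exp (of_nat (vil_digit m n s) * (2 * of_real pi * \<i> / of_nat (m s)))"
      unfolding exp_of_nat_mult by (simp add: vil_r_def e_def)
    finally show ?thesis by (simp add: mult_ac)
  qed
  define w where "w = vil_psi m j e * cnj (vil_psi m k e)"
  have "w = exp (2 * of_real pi * \<i> * of_int (int (vil_digit m j s) - int (vil_digit m k s)) / of_nat (m s))"
    by (simp add: w_def psi_e exp_cnj mult_exp_exp diff_divide_distrib algebra_simps)
  \<comment> \<open>Both digits lie below \<open>m s\<close>, so being distinct they are
    incongruent.\<close>
  moreover have "\<not> int (m s) dvd int (vil_digit m j s) - int (vil_digit m k s)"
    using s vil_digit_expansion(3)[of m j s, OF m2] vil_digit_expansion(3)[of m k s, OF m2]
    by (simp add: mod_eq_dvd_iff[symmetric])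
  ultimately have w: "w \<noteq> 1" using exp_root_eq_1_iff[OF m_pos] by metis
  let ?h = "\<lambda>x. vil_psi m j x * cnj (vil_psi m k x)"
  have "(LINT x|vil_haar m. ?h x) = (LINT x|distr (vil_haar m) (vil_haar m) (\<lambda>z. e \<otimes>\<^bsub>vil_group m\<^esub> z). ?h x)"
    using vil_haar_translate[of m, OF m2 e] by simp
  also have "\<dots> = (LINT x|vil_haar m. ?h (e \<otimes>\<^bsub>vil_group m\<^esub> x))"
    by (rule integral_distr[OF vil_translate_measurable[of m, OF m2 e]]) measurable
  also have "\<dots> = (LINT x|vil_haar m. w * ?h x)"
    by (rule Bochner_Integration.integral_cong) (simp_all add: vil_psi_mult w_def)
  also have "\<dots> = w * (LINT x|vil_haar m. ?h x)"
    by simp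
  finally show ?thesis using w False by simp
qed

section \<open>Coefficients and partial sums of martingales\<close>

lemma vil_coeff_cong:
  "(\<And>x. x \<in> vil_points m \<Longrightarrow> f x = g x) \<Longrightarrow> vil_coeff m f k = vil_coeff m g k"
  unfolding vil_coeff_def by (rule Bochner_Integration.integral_cong) (simp_all add: space_vil_haar)

lemma vil_coeff_sum:
  assumes "finite A"
  shows "vil_coeff m (\<lambda>x. \<Sum>j\<in>A. c j * vil_psi m j x) k = (if k \<in> A then c k else 0)"
proof -
  have "vil_coeff m (\<lambda>x. \<Sum>j\<in>A. c j * vil_psi m j x) k =
      (LINT x|vil_haar m. (\<Sum>j\<in>A. c j * (vil_psi m j x * cnj (vil_psi m k x))))"
    unfolding vil_coeff_def by (simp only: sum_distrib_right mult.assoc)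
  also have "\<dots> = (\<Sum>j\<in>A. LINT x|vil_haar m. c j * (vil_psi m j x * cnj (vil_psi m k x)))"
    by (rule Bochner_Integration.integral_sum)
      (intro integrable_mult_right integrable_vil_psi_mult integrable_vil_psi)
  also have "\<dots> = (\<Sum>j\<in>A. if k = j then c j else 0)"
    by (rule sum.cong) (auto simp: vil_psi_orthonormal)
  finally show ?thesis using assms by simp
qed

text \<open>\<open>f N\<close> is a partial sum of every later \<open>f i\<close>, so orthonormality
  makes the coefficients agree from \<open>N\<close> on: the defining limit is that of an eventually
  constant sequence.\<close>

lemma mart_coeff_eq:
  assumes f: "vil_martingale m f" and k: "k < vil_M m N"
  shows "mart_coeff m f k = vil_coeff m (f N) k"
proof -
  have "vil_coeff m (f i) k = vil_coeff m (f N) k" if "N \<le> i" for i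
  proof -
    have "vil_coeff m (f N) k = vil_coeff m (\<lambda>x. \<Sum>j<vil_M m N. vil_coeff m (f i) j * vil_psi m j x) k"
      by (rule vil_coeff_cong) (use f that in \<open>simp only: vil_martingale_def flip: vil_S_def\<close>)
    also have "\<dots> = vil_coeff m (f i) k" by (subst vil_coeff_sum) (use k in auto)
    finally show ?thesis by simp
  qed
  then have "\<forall>\<^sub>F i in sequentially. vil_coeff m (f i) k = vil_coeff m (f N) k"
    by (rule eventually_sequentiallyI)
  then show ?thesis
    unfolding mart_coeff_def by (intro limI tendsto_eventually)
qed

text \<open>All indices below \<open>n\<close> lie below \<open>M\<^sub>N\<close>, so the single
  function \<open>f N\<close> yields every coefficient, and the finite sum moves under the
  integral.\<close>

lemma mart_S_eq_integral:
  assumes f: "vil_martingale m f" and n: "n \<le> vil_M m N"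
  shows "mart_S m n f x = (LINT t|vil_haar m. f N t * vil_kernel m n x t)"
proof -
  have int: "integrable (vil_haar m) (f N)" using f by (simp add: vil_martingale_def)
  have "(LINT t|vil_haar m. f N t * vil_kernel m n x t) =
      (LINT t|vil_haar m. (\<Sum>k<n. f N t * cnj (vil_psi m k t) * vil_psi m k x))"
    by (simp add: vil_kernel_def sum_distrib_left mult_ac)
  also have "\<dots> = (\<Sum>k<n. LINT t|vil_haar m. f N t * cnj (vil_psi m k t) * vil_psi m k x)"
    by (rule Bochner_Integration.integral_sum)
      (intro integrable_mult_left integrable_vil_psi_mult int)
  also have "\<dots> = (\<Sum>k<n. vil_coeff m (f N) k * vil_psi m k x)"
    by (simp add: vil_coeff_def)
  also have "\<dots> = mart_S m n f x"
    unfolding mart_S_def by (rule sum.cong) (use mart_coeff_eq[OF f, of _ N] n in auto)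
  finally show ?thesis by simp
qed

text \<open>\<open>f N\<close> equals its own partial sum of order \<open>M\<^sub>N\<close>, a
  combination of characters that are constant on these cylinders.\<close>

lemma mart_const_on_cyl:
  assumes f: "vil_martingale m f" and x: "x \<in> vil_points m" and y: "y \<in> vil_cyl m N x"
  shows "f N y = f N x"
proof -
  have eq: "f N z = (\<Sum>k<vil_M m N. vil_coeff m (f N) k * vil_psi m k z)" if "z \<in> vil_points m" for z
  proof -
    have "vil_S m (vil_M m N) (f N) z = f N z"
      using f that order_refl[of N] unfolding vil_martingale_def by blast
    then show ?thesis by (simp only: vil_S_def)
  qed
  have "y \<in> vil_points m" using y by (simp add: vil_cyl_def)
  then have "f N y = (\<Sum>k<vil_M m N. vil_coeff m (f N) k * vil_psi m k y)" by (rule eq)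
  also have "\<dots> = (\<Sum>k<vil_M m N. vil_coeff m (f N) k * vil_psi m k x)"
  proof (rule sum.cong[OF refl])
    fix k assume "k \<in> {..<vil_M m N}"
    then have "vil_psi m k y = vil_psi m k x"
      by (intro vil_psi_cong) (use y in \<open>auto simp: vil_cyl_def\<close>)
    then show "vil_coeff m (f N) k * vil_psi m k y = vil_coeff m (f N) k * vil_psi m k x" by simp
  qed
  also have "\<dots> = f N x" using eq[OF x] by simp
  finally show ?thesis .
qed

section \<open>The weighted maximal operator\<close>

text \<open>Each value of \<open>h\<close> is taken on a set of measure at least \<open>1 / M\<^sub>N\<close>, so \<open>h\<close> is bounded by
  the \<open>p\<close>-th root of \<open>M\<^sub>N \<integral> h\<^sup>p\<close>; split \<open>h = h\<^sup>p h\<^sup>1\<^sup>-\<^sup>p\<close>.\<close>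

lemma nn_integral_powr_step_le:
  assumes p: "0 < p" "p < 1"
    and h[measurable]: "h \<in> borel_measurable (vil_haar m)" and nn: "\<And>x. 0 \<le> h x"
    and step: "\<And>x y. x \<in> vil_points m \<Longrightarrow> y \<in> vil_cyl m N x \<Longrightarrow> h y = h x"
  shows "enn_powr (\<integral>\<^sup>+x. ennreal (h x) \<partial>vil_haar m) p
    \<le> ennreal (real (vil_M m N) powr (1 - p)) * (\<integral>\<^sup>+x. ennreal (h x powr p) \<partial>vil_haar m)"
proof (cases "\<integral>\<^sup>+x. ennreal (h x powr p) \<partial>vil_haar m")
  case top
  then show ?thesis by (simp add: ennreal_mult_top gr_implies_not_zero[OF vil_M_positive])
next
  case (real J)
  define A where "A = real (vil_M m N) * J"
  have A: "0 \<le> A" using real by (simp add: A_def)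
  have le: "h x \<le> A powr (1 / p)" if x: "x \<in> vil_points m" for x
  proof -
    have "ennreal (h x powr p / real (vil_M m N)) = ennreal (h x powr p) * emeasure (vil_haar m) (vil_cyl m N x)"
      using emeasure_vil_cyl[of m, OF m2 x, of N] by (simp flip: ennreal_mult')
    also have "\<dots> = (\<integral>\<^sup>+y. ennreal (h x powr p) * indicator (vil_cyl m N x) y \<partial>vil_haar m)"
      using x by (subst nn_integral_cmult_indicator) auto
    also have "\<dots> \<le> (\<integral>\<^sup>+y. ennreal (h y powr p) \<partial>vil_haar m)"
      by (rule nn_integral_mono) (use step[OF x] in \<open>auto simp: indicator_def\<close>)
    finally have "h x powr p \<le> A"
      using real vil_M_positive[of N] by (simp add: A_def field_simps)
    then have "(h x powr p) powr (1 / p) \<le> A powr (1 / p)"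
      using p by (intro powr_mono2) auto
    then show ?thesis using p nn[of x] by (simp add: powr_powr)
  qed
  have "(\<integral>\<^sup>+x. ennreal (h x) \<partial>vil_haar m) \<le>
      (\<integral>\<^sup>+x. ennreal (A powr ((1 - p) / p)) * ennreal (h x powr p) \<partial>vil_haar m)"
  proof (rule nn_integral_mono)
    fix x assume "x \<in> space (vil_haar m)"
    then have x: "x \<in> vil_points m" by (simp add: space_vil_haar)
    have "h x = h x powr (1 - p) * h x powr p"
      using nn[of x] by (simp flip: powr_add)
    also have "\<dots> \<le> (A powr (1 / p)) powr (1 - p) * h x powr p"
      using le[OF x] nn[of x] p by (intro mult_right_mono powr_mono2) auto
    finally show "ennreal (h x) \<le> ennreal (A powr ((1 - p) / p)) * ennreal (h x powr p)"
      by (simp add: powr_powr flip: ennreal_mult)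
  qed
  also have "\<dots> = ennreal (A powr ((1 - p) / p)) * ennreal J"
    by (subst nn_integral_cmult) (use real in auto)
  finally have "enn_powr (\<integral>\<^sup>+x. ennreal (h x) \<partial>vil_haar m) p \<le> ennreal ((A powr ((1 - p) / p) * J) powr p)"
    using enn_powr_mono[OF p(1), of "\<integral>\<^sup>+x. ennreal (h x) \<partial>vil_haar m" "ennreal (A powr ((1 - p) / p) * J)"] real
    by (simp add: enn_powr_ennreal flip: ennreal_mult)
  \<comment> \<open>The left side is \<open>A\<close> to the power \<open>1 - p\<close> times
    \<open>J\<close> to the power \<open>p\<close>; with \<open>A = M\<^sub>N J\<close> the powers
    of \<open>J\<close> recombine to \<open>J\<close>.\<close>
  also have "(A powr ((1 - p) / p) * J) powr p = real (vil_M m N) powr (1 - p) * (J powr (1 - p) * J powr p)"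
    using p real by (simp add: powr_mult powr_powr A_def)
  also have "J powr (1 - p) * J powr p = J"
    using real by (simp flip: powr_add)
  finally show ?thesis using real by (simp add: ennreal_mult)
qed

text \<open>A Tonelli argument: each \<open>t\<close> lies in \<open>I\<^sub>j(x)\<close> for a set
  of \<open>x\<close> of measure \<open>1/M\<^sub>j\<close>. As there are finitely many cylinders,
  the inner integral is a finite sum of indicators in \<open>x\<close>, which also gives
  measurability.\<close>

lemma nn_integral_vil_cyl:
  assumes g[measurable]: "g \<in> borel_measurable (vil_haar m)"
  shows nn_integral_vil_cyl_measurable:
      "(\<lambda>x. \<integral>\<^sup>+t. g t * indicator (vil_cyl m j x) t \<partial>vil_haar m) \<in> borel_measurable (vil_haar m)"
    and nn_integral_vil_cyl_eq:
      "(\<integral>\<^sup>+x. (\<integral>\<^sup>+t. g t * indicator (vil_cyl m j x) t \<partial>vil_haar m) \<partial>vil_haar m)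
        = ennreal (1 / real (vil_M m j)) * (\<integral>\<^sup>+t. g t \<partial>vil_haar m)"
proof -
  let ?Cs = "vil_cyl m j ` vil_points m"
  let ?a = "\<lambda>C. \<integral>\<^sup>+t. g t * indicator C t \<partial>vil_haar m"
  have fin: "finite ?Cs" by (rule finite_vil_cyls[of m, OF m2])
  have [measurable]: "C \<in> sets (vil_haar m)" if "C \<in> ?Cs" for C using that by auto
  \<comment> \<open>Exactly one cylinder of level \<open>j\<close> contains \<open>x\<close>; this
    collapses the sums over \<open>?Cs\<close> below.\<close>
  have ind: "indicator C x = (if C = vil_cyl m j x then 1 else (0::ennreal))"
    if "C \<in> ?Cs" "x \<in> vil_points m" for C x
  proof (cases "x \<in> C")
    case True
    then show ?thesis using that(1) vil_cyl_eq by fastforce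
  next
    case False
    then show ?thesis using vil_cyl_self[OF that(2)] by auto
  qed
  have sum: "?a (vil_cyl m j x) = (\<Sum>C\<in>?Cs. indicator C x * ?a C)" if "x \<in> vil_points m" for x
  proof -
    have "(\<Sum>C\<in>?Cs. indicator C x * ?a C) = (\<Sum>C\<in>?Cs. if C = vil_cyl m j x then ?a C else 0)"
      by (rule sum.cong) (auto simp: ind[OF _ that])
    then show ?thesis using fin that by simp
  qed
  show "(\<lambda>x. ?a (vil_cyl m j x)) \<in> borel_measurable (vil_haar m)"
    by (subst measurable_cong[of _ _ "\<lambda>x. \<Sum>C\<in>?Cs. indicator C x * ?a C"]) (auto simp: sum space_vil_haar)
  have "(\<integral>\<^sup>+x. ?a (vil_cyl m j x) \<partial>vil_haar m) = (\<integral>\<^sup>+x. (\<Sum>C\<in>?Cs. indicator C x * ?a C) \<partial>vil_haar m)"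
    by (rule nn_integral_cong) (simp add: sum space_vil_haar)
  also have "\<dots> = (\<Sum>C\<in>?Cs. \<integral>\<^sup>+x. indicator C x * ?a C \<partial>vil_haar m)"
    by (rule nn_integral_sum) measurable
  also have "\<dots> = (\<Sum>C\<in>?Cs. ennreal (1 / real (vil_M m j)) * ?a C)"
  proof (rule sum.cong[OF refl])
    fix C assume C: "C \<in> ?Cs"
    then have "emeasure (vil_haar m) C = ennreal (1 / real (vil_M m j))"
      using emeasure_vil_cyl[of m, OF m2] by auto
    with C show "(\<integral>\<^sup>+x. indicator C x * ?a C \<partial>vil_haar m) = ennreal (1 / real (vil_M m j)) * ?a C"
      by (subst nn_integral_multc) auto
  qed
  also have "\<dots> = ennreal (1 / real (vil_M m j)) * (\<integral>\<^sup>+t. (\<Sum>C\<in>?Cs. g t * indicator C t) \<partial>vil_haar m)"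
    by (subst nn_integral_sum) (auto simp: sum_distrib_left)
  also have "(\<integral>\<^sup>+t. (\<Sum>C\<in>?Cs. g t * indicator C t) \<partial>vil_haar m) = (\<integral>\<^sup>+t. g t \<partial>vil_haar m)"
  proof (rule nn_integral_cong)
    fix t assume "t \<in> space (vil_haar m)"
    then have t: "t \<in> vil_points m" by (simp add: space_vil_haar)
    have "(\<Sum>C\<in>?Cs. g t * indicator C t) = (\<Sum>C\<in>?Cs. if C = vil_cyl m j t then g t else 0)"
      by (rule sum.cong) (auto simp: ind[OF _ t])
    then show "(\<Sum>C\<in>?Cs. g t * indicator C t) = g t" using fin t by simp
  qed
  finally show "(\<integral>\<^sup>+x. ?a (vil_cyl m j x) \<partial>vil_haar m)
      = ennreal (1 / real (vil_M m j)) * (\<integral>\<^sup>+t. g t \<partial>vil_haar m)" .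
qed

text \<open>\<open>N\<close> precedes the least \<open>L\<close> with \<open>n < vil_M m L\<close>;
  that \<open>L\<close> is not \<open>0\<close> because \<open>vil_M m 0 = 1\<close>.\<close>

lemma vil_M_bracket:
  assumes "1 \<le> n"
  obtains N where "vil_M m N \<le> n" "n < vil_M m (Suc N)"
proof -
  have "n < vil_M m n"
    using less_exp[of n] vil_M_ge[of m n, OF m2] by (rule less_le_trans)
  then have L: "n < vil_M m (LEAST L. n < vil_M m L)" by (rule LeastI)
  then have "(LEAST L. n < vil_M m L) \<noteq> 0" using assms by (intro notI) simp
  then obtain N where N: "(LEAST L. n < vil_M m L) = Suc N" by (meson not0_implies_Suc)
  have "\<not> n < vil_M m N" by (rule not_less_Least) (simp add: N)
  then show ?thesis using that[of N] L N by simp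
qed

lemma mart_max_measurable:
  assumes "vil_martingale m f"
  shows "mart_max f \<in> borel_measurable (vil_haar m)"
proof -
  have [measurable]: "f n \<in> borel_measurable (vil_haar m)" for n
    using assms by (intro borel_measurable_integrable) (simp add: vil_martingale_def)
  show ?thesis unfolding mart_max_def[abs_def] by measurable
qed

lemma enn_powr_norm_le_mart_max:
  "0 < p \<Longrightarrow> ennreal (norm (f n x) powr p) \<le> enn_powr (mart_max f x) p"
  unfolding mart_max_def
  by (subst enn_powr_ennreal[symmetric]) (auto intro!: enn_powr_mono SUP_upper)

end

locale bounded_vilenkin = vilenkin +
  fixes B :: nat
  assumes m_le: "m k \<le> B"
begin

section \<open>Pointwise majorant and boundedness of the maximal operator\<close>

lemma vil_M_Suc_le: "real (vil_M m (Suc k)) \<le> real B * real (vil_M m k)"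
  using m_le[of k] by (simp add: mult_right_mono)

lemma B_ge_2: "2 \<le> B"
  using m_le[of 0] m2[of 0] by simp

text \<open>Combines the integral representation, the inequality for step functions and the kernel
  bound. One \<open>B\<close> to the power \<open>p\<close> is lost in replacing
  \<open>M\<^sub>s\<^sub>+\<^sub>1\<close> by \<open>M\<^sub>s\<close>.\<close>

lemma mart_S_powr_le:
  assumes p: "0 < p" "p < 1" and f: "vil_martingale m f" and x: "x \<in> vil_points m"
    and n: "n \<le> vil_M m (Suc N)"
  shows "enn_powr (ennreal (norm (mart_S m n f x))) p
    \<le> ennreal (real (vil_M m (Suc N)) powr (1 - p) * real B powr p) *
      (\<Sum>j. ennreal (real (vil_M m j) powr p) *
        (\<integral>\<^sup>+t. enn_powr (mart_max f t) p * indicator (vil_cyl m j x) t \<partial>vil_haar m))"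
proof -
  note mart_max_measurable[OF f, measurable] vil_cyl_sets[OF x, measurable]
  have int: "integrable (vil_haar m) (f (Suc N))" using f by (simp add: vil_martingale_def)
  then have [measurable]: "f (Suc N) \<in> borel_measurable (vil_haar m)" by simp
  define h where "h = (\<lambda>t. norm (f (Suc N) t * vil_kernel m n x t))"
  have h[measurable]: "h \<in> borel_measurable (vil_haar m)" unfolding h_def by measurable
  \<comment> \<open>Both factors of \<open>h\<close> depend only on the first \<open>Suc N\<close>
    coordinates, the kernel because \<open>n \<le> vil_M m (Suc N)\<close>.\<close>
  have step: "h y = h z" if "z \<in> vil_points m" "y \<in> vil_cyl m (Suc N) z" for y z
    using mart_const_on_cyl[OF f that] vil_kernel_cong[OF n, of y z x] that(2)
    by (simp add: h_def vil_cyl_def)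
  have "ennreal (norm (mart_S m n f x)) \<le> (\<integral>\<^sup>+t. ennreal (h t) \<partial>vil_haar m)"
    unfolding mart_S_eq_integral[OF f n] h_def
    by (intro integral_norm_bound_ennreal integrable_mult_bounded[OF int _ norm_vil_kernel_le]) measurable
  then have "enn_powr (ennreal (norm (mart_S m n f x))) p \<le> enn_powr (\<integral>\<^sup>+t. ennreal (h t) \<partial>vil_haar m) p"
    by (rule enn_powr_mono[OF p(1)])
  also have "\<dots> \<le> ennreal (real (vil_M m (Suc N)) powr (1 - p)) * (\<integral>\<^sup>+t. ennreal (h t powr p) \<partial>vil_haar m)"
    by (rule nn_integral_powr_step_le[OF p h _ step]) (simp_all add: h_def)
  also have "(\<integral>\<^sup>+t. ennreal (h t powr p) \<partial>vil_haar m) \<le> (\<integral>\<^sup>+t. ennreal (real B powr p) *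
      (\<Sum>j. ennreal (real (vil_M m j) powr p) * (enn_powr (mart_max f t) p * indicator (vil_cyl m j x) t)) \<partial>vil_haar m)"
  proof (rule nn_integral_mono)
    fix t assume "t \<in> space (vil_haar m)"
    then have t: "t \<in> vil_points m" by (simp add: space_vil_haar)
    let ?g = "\<lambda>j. ennreal (real (vil_M m j) powr p) * (enn_powr (mart_max f t) p * indicator (vil_cyl m j x) t)"
    obtain s where s: "t \<in> vil_cyl m s x" "norm (vil_kernel m n x t) \<le> real (vil_M m (Suc s))"
      by (rule norm_vil_kernel_cyl[OF x t n])
    have "h t \<le> norm (f (Suc N) t) * (real B * real (vil_M m s))"
      unfolding h_def norm_mult by (intro mult_left_mono order_trans[OF s(2)] vil_M_Suc_le) simp
    then have "h t powr p \<le> (norm (f (Suc N) t) * (real B * real (vil_M m s))) powr p"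
      using p by (intro powr_mono2) (auto simp: h_def)
    also have "\<dots> = real B powr p * (real (vil_M m s) powr p * norm (f (Suc N) t) powr p)"
      by (simp add: powr_mult mult_ac)
    finally have "ennreal (h t powr p) \<le>
        ennreal (real B powr p) * (ennreal (real (vil_M m s) powr p) * ennreal (norm (f (Suc N) t) powr p))"
      by (simp add: ennreal_leI flip: ennreal_mult)
    also have "\<dots> \<le> ennreal (real B powr p) * ?g s"
      using s(1) enn_powr_norm_le_mart_max[OF p(1)] by (auto intro!: mult_left_mono)
    \<comment> \<open>The level \<open>s\<close> depends on \<open>t\<close>; passing to the whole
      series gives a majorant of one form for all \<open>t\<close>.\<close>
    also have "?g s \<le> (\<Sum>j. ?g j)"
      using sum_le_suminf[of ?g "{s}"] by simp
    finally show "ennreal (h t powr p) \<le> ennreal (real B powr p) * (\<Sum>j. ?g j)"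
      by (simp add: mult_left_mono)
  qed
  also have "\<dots> = ennreal (real B powr p) * (\<Sum>j. ennreal (real (vil_M m j) powr p) *
        (\<integral>\<^sup>+t. enn_powr (mart_max f t) p * indicator (vil_cyl m j x) t \<partial>vil_haar m))"
    by (simp add: nn_integral_cmult nn_integral_suminf)
  finally show ?thesis by (simp add: ennreal_mult mult.assoc mult_left_mono)
qed

text \<open>The \<open>p\<close>-th power of the weight contributes
  \<open>(n + 1) powr (p - 1)\<close>. Since \<open>vil_M m (Suc N) \<le> B * (n + 1)\<close>, it
  cancels the growing factor of \<open>mart_S_powr_le\<close> up to
  \<open>B powr (1 - p) * B powr p = B\<close>.\<close>

lemma weighted_max_S_powr_le:
  assumes p: "0 < p" "p < 1" and f: "vil_martingale m f" and x: "x \<in> vil_points m"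
  shows "enn_powr (weighted_max_S m p f x) p
    \<le> ennreal (real B) * (\<Sum>j. ennreal (real (vil_M m j) powr p) *
        (\<integral>\<^sup>+t. enn_powr (mart_max f t) p * indicator (vil_cyl m j x) t \<partial>vil_haar m))"
    (is "_ \<le> _ * ?G")
  unfolding weighted_max_S_def
proof (rule enn_powr_SUP_le[OF p(1)])
  fix n :: nat
  \<comment> \<open>Bracketing \<open>n + 1\<close> matches the weight and covers
    \<open>n = 0\<close>.\<close>
  obtain N where N: "vil_M m N \<le> n + 1" "n + 1 < vil_M m (Suc N)"
    using vil_M_bracket[of "n + 1"] by auto
  let ?n = "real (n + 1)" and ?M = "real (vil_M m (Suc N))"
  have "?M \<le> real B * real (vil_M m N)" by (rule vil_M_Suc_le)
  also have "\<dots> \<le> real B * ?n" using N(1) by (intro mult_left_mono) (simp_all only: of_nat_le_iff of_nat_0_le_iff)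
  finally have "?M powr (1 - p) \<le> (real B * ?n) powr (1 - p)" using p by (intro powr_mono2) auto
  then have "?M powr (1 - p) * real B powr p \<le> (real B * ?n) powr (1 - p) * real B powr p"
    by (rule mult_right_mono) simp
  also have "\<dots> = real B powr (1 - p) * real B powr p * ?n powr (1 - p)"
    by (simp add: powr_mult mult_ac)
  also have "real B powr (1 - p) * real B powr p = real B"
    using B_ge_2 by (simp flip: powr_add)
  finally have "?n powr (p - 1) * (?M powr (1 - p) * real B powr p) \<le> ?n powr (p - 1) * (real B * ?n powr (1 - p))"
    by (rule mult_left_mono) simp
  also have "\<dots> = real B * (?n powr (p - 1) * ?n powr (1 - p))" by (simp only: ac_simps)
  also have "?n powr (p - 1) * ?n powr (1 - p) = 1" by (simp flip: powr_add)
  finally have const: "?n powr (p - 1) * (?M powr (1 - p) * real B powr p) \<le> real B" by simp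
  have "1 / ?n powr (1 / p - 1) = ?n powr (1 - 1 / p)"
    by (simp add: powr_minus_divide[symmetric])
  then have "(1 / ?n powr (1 / p - 1)) powr p = ?n powr ((1 - 1 / p) * p)"
    by (simp only: powr_powr)
  also have "(1 - 1 / p) * p = p - 1" using p by (simp add: field_simps)
  finally have w: "(1 / ?n powr (1 / p - 1)) powr p = ?n powr (p - 1)" .
  have "ennreal (norm (mart_S m n f x) / ?n powr (1 / p - 1)) =
      ennreal (1 / ?n powr (1 / p - 1)) * ennreal (norm (mart_S m n f x))"
    by (simp flip: ennreal_mult)
  then have "enn_powr (ennreal (norm (mart_S m n f x) / ?n powr (1 / p - 1))) p =
      ennreal (?n powr (p - 1)) * enn_powr (ennreal (norm (mart_S m n f x))) p"
    using w by (simp only: enn_powr_mult[OF p(1)]) (simp add: enn_powr_ennreal)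
  also have "\<dots> \<le> ennreal (?n powr (p - 1)) * (ennreal (?M powr (1 - p) * real B powr p) * ?G)"
    by (intro mult_left_mono mart_S_powr_le p f x) (use N in auto)
  also have "\<dots> = ennreal (?n powr (p - 1) * (?M powr (1 - p) * real B powr p)) * ?G"
    by (simp add: ennreal_mult mult.assoc)
  also have "\<dots> \<le> ennreal (real B) * ?G"
    by (intro mult_right_mono ennreal_leI const) simp
  finally show "enn_powr (ennreal (norm (mart_S m n f x) / ?n powr (1 / p - 1))) p \<le> ennreal (real B) * ?G" .
qed

text \<open>Comparison with a geometric series, as \<open>2 ^ j \<le> vil_M m j\<close> and the
  exponent is negative.\<close>

lemma summable_vil_M_powr:
  assumes "p < 1"
  shows "summable (\<lambda>j. real (vil_M m j) powr (p - 1))"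
proof (rule summable_comparison_test)
  show "summable (\<lambda>j. (2 powr (p - 1)) ^ j)"
    using assms powr_less_mono[of "p - 1" 0 2] by (intro summable_geometric) simp
  have "real (vil_M m j) powr (p - 1) \<le> (2 powr (p - 1)) ^ j" for j
  proof -
    have "real (2 ^ j) \<le> real (vil_M m j)" unfolding of_nat_le_iff by (rule vil_M_ge[OF m2])
    then have "real (vil_M m j) powr (p - 1) \<le> (2 ^ j) powr (p - 1)"
      using assms by (intro powr_mono2') auto
    then show ?thesis by (simp add: powr_power powr_realpow[symmetric] powr_powr mult.commute)
  qed
  then show "\<exists>N. \<forall>j\<ge>N. norm (real (vil_M m j) powr (p - 1)) \<le> (2 powr (p - 1)) ^ j" by simp
qed

lemma bounded_weighted_max_S:
  assumes p: "0 < p" "p < 1"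
  shows "bounded_Hp_Lp m p (weighted_max_S m p)"
proof -
  \<comment> \<open>The exponent is \<open>p\<close> from the kernel bound minus \<open>1\<close>
    from the measure of the cylinder; the final constant is
    \<open>(B * S) powr (1 / p)\<close>.\<close>
  define S where "S = (\<Sum>j. real (vil_M m j) powr (p - 1))"
  have S: "0 \<le> S" unfolding S_def by (rule suminf_nonneg[OF summable_vil_M_powr[OF p(2)]]) simp
  show ?thesis
    unfolding bounded_Hp_Lp_def
  proof (intro exI ballI)
    fix f assume "f \<in> Hp_space m p"
    then have f: "vil_martingale m f" by (simp add: Hp_space_def)
    note mart_max_measurable[OF f, measurable]
    let ?g = "\<lambda>t. enn_powr (mart_max f t) p"
    have g[measurable]: "?g \<in> borel_measurable (vil_haar m)" by measurable
    note nn_integral_vil_cyl_measurable[OF g, measurable]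
    have "(\<integral>\<^sup>+x. enn_powr (weighted_max_S m p f x) p \<partial>vil_haar m) \<le>
        (\<integral>\<^sup>+x. ennreal (real B) * (\<Sum>j. ennreal (real (vil_M m j) powr p) *
        (\<integral>\<^sup>+t. ?g t * indicator (vil_cyl m j x) t \<partial>vil_haar m)) \<partial>vil_haar m)"
      by (intro nn_integral_mono weighted_max_S_powr_le p f) (simp add: space_vil_haar)
    also have "\<dots> = ennreal (real B) * (\<Sum>j. ennreal (real (vil_M m j) powr p) *
        (ennreal (1 / real (vil_M m j)) * (\<integral>\<^sup>+t. ?g t \<partial>vil_haar m)))"
      by (simp add: nn_integral_cmult nn_integral_suminf nn_integral_vil_cyl_eq)
    also have "\<dots> = ennreal (real B) * ((\<Sum>j. ennreal (real (vil_M m j) powr (p - 1))) * (\<integral>\<^sup>+t. ?g t \<partial>vil_haar m))"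
      by (simp add: powr_diff mult.assoc[symmetric] flip: ennreal_mult ennreal_suminf_multc)
    also have "(\<Sum>j. ennreal (real (vil_M m j) powr (p - 1))) = ennreal S"
      unfolding S_def by (intro suminf_ennreal2 summable_vil_M_powr p) simp
    finally have "(\<integral>\<^sup>+x. enn_powr (weighted_max_S m p f x) p \<partial>vil_haar m) \<le>
        ennreal (real B * S) * (\<integral>\<^sup>+t. ?g t \<partial>vil_haar m)"
      using S by (simp add: ennreal_mult mult.assoc)
    then have "enn_powr (\<integral>\<^sup>+x. enn_powr (weighted_max_S m p f x) p \<partial>vil_haar m) (1 / p) \<le>
        enn_powr (ennreal (real B * S) * (\<integral>\<^sup>+t. ?g t \<partial>vil_haar m)) (1 / p)"
      using p by (intro enn_powr_mono) auto
    also have "\<dots> = ennreal ((real B * S) powr (1 / p)) * enn_powr (\<integral>\<^sup>+t. ?g t \<partial>vil_haar m) (1 / p)"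
      using p S by (simp add: enn_powr_mult enn_powr_ennreal)
    finally show "Lp_norm m p (weighted_max_S m p f) \<le> ennreal ((real B * S) powr (1 / p)) * Hp_norm m p f"
      by (simp add: Lp_norm_def Hp_norm_def)
  qed
qed

section \<open>Sharpness of the weights\<close>

abbreviation vil_block :: "nat \<Rightarrow> (nat \<Rightarrow> int) \<Rightarrow> complex" where
  "vil_block a x \<equiv> vil_D m (vil_M m (a + 1)) x - vil_D m (vil_M m a) x"

text \<open>The coefficients \<open>1\<close> are kept so that \<open>vil_coeff_sum\<close> matches.\<close>

lemma vil_block_eq: "vil_block a x = (\<Sum>j\<in>{vil_M m a..<vil_M m (a + 1)}. 1 * vil_psi m j x)"
  unfolding vil_D_def using sum_diff_nat_ivl[of 0 "vil_M m a" "vil_M m (a + 1)" "\<lambda>j. vil_psi m j x"]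
    vil_M_mono[of a "a + 1"] by (simp only: atLeast0LessThan mult_1 le_add1 le0)

lemma vil_S_block:
  "vil_S m n (vil_block a) x = (\<Sum>j\<in>{..<n} \<inter> {vil_M m a..<vil_M m (a + 1)}. vil_psi m j x)"
proof -
  have "vil_coeff m (vil_block a) k = (if k \<in> {vil_M m a..<vil_M m (a + 1)} then 1 else 0)" for k
    unfolding vil_block_eq by (rule vil_coeff_sum) simp
  then have "vil_S m n (vil_block a) x =
      (\<Sum>j<n. if j \<in> {vil_M m a..<vil_M m (a + 1)} then vil_psi m j x else 0)"
    unfolding vil_S_def by (intro sum.cong) (simp_all only: if_distrib[of "\<lambda>z. z * _"] mult_1 mult_zero_left)
  then show ?thesis by (simp only: sum.inter_restrict finite_lessThan)
qed

lemma vil_S_block_Suc: "vil_S m (vil_M m a + 1) (vil_block a) x = vil_psi m (vil_M m a) x"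
proof -
  \<comment> \<open>The strict growth puts the index \<open>vil_M m a\<close> inside the
    block.\<close>
  have "1 * vil_M m a < m a * vil_M m a" using m2[of a] by (intro mult_strict_right_mono) auto
  then have "{..<vil_M m a + 1} \<inter> {vil_M m a..<vil_M m (a + 1)} = {vil_M m a}" by auto
  then show ?thesis by (simp only: vil_S_block sum.insert sum.empty finite.emptyI empty_iff) simp
qed

text \<open>No \<open>M\<^sub>i\<close> lies strictly inside the block, so each member of the
  martingale is either \<open>0\<close> or the whole block.\<close>

lemma mart_max_block_le: "mart_max (mart_of m (vil_block a)) x \<le> ennreal (norm (vil_block a x))"
  unfolding mart_max_def
proof (rule SUP_least)
  fix i
  show "ennreal (norm (mart_of m (vil_block a) i x)) \<le> ennreal (norm (vil_block a x))"
  proof (cases "i \<le> a")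
    case True
    then have "{..<vil_M m i} \<inter> {vil_M m a..<vil_M m (a + 1)} = {}"
      using vil_M_mono[OF True] by auto
    then show ?thesis by (simp only: mart_of_def vil_S_block sum.empty norm_zero) simp
  next
    case False
    then have "vil_M m (a + 1) \<le> vil_M m i" by (intro vil_M_mono) simp
    then have "{..<vil_M m i} \<inter> {vil_M m a..<vil_M m (a + 1)} = {vil_M m a..<vil_M m (a + 1)}" by auto
    then have "mart_of m (vil_block a) i x = vil_block a x"
      unfolding mart_of_def vil_S_block by (simp only: vil_block_eq mult_1)
    then show ?thesis by (simp only: order_refl)
  qed
qed

lemma zero_in_vil_points: "(\<lambda>_. 0) \<in> vil_points m"
  by (simp add: vil_group_def PiE_iff)

lemma vil_D_eq_kernel: "vil_D m n x = vil_kernel m n x (\<lambda>_. 0)"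
  by (simp add: vil_D_def vil_kernel_def vil_psi_def vil_r_def)

text \<open>The block is \<open>M\<^sub>a\<^sub>+\<^sub>1 - M\<^sub>a\<close> on the inner cylinder
  around the origin, \<open>- M\<^sub>a\<close> on the rest of the outer one, and \<open>0\<close>
  elsewhere.\<close>

lemma norm_vil_block_le:
  assumes x: "x \<in> vil_points m"
  shows "norm (vil_block a x) \<le> real (vil_M m (a + 1)) * indicator (vil_cyl m a (\<lambda>_. 0)) x"
proof -
  have iff: "(\<lambda>_. 0) \<in> vil_cyl m n x \<longleftrightarrow> x \<in> vil_cyl m n (\<lambda>_. 0)" for n
    using x zero_in_vil_points by (auto simp: vil_cyl_def)
  have D: "vil_D m (vil_M m n) x = of_real (real (vil_M m n) * indicator (vil_cyl m n (\<lambda>_. 0)) x)" for n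
    unfolding vil_D_eq_kernel vil_kernel_M[OF x zero_in_vil_points] iff by (simp add: indicator_def)
  have "x \<in> vil_cyl m (a + 1) (\<lambda>_. 0) \<Longrightarrow> x \<in> vil_cyl m a (\<lambda>_. 0)"
    using vil_cyl_mono[of a "a + 1"] by auto
  moreover have "real (vil_M m a) \<le> real (vil_M m (a + 1))"
    unfolding of_nat_le_iff by (rule vil_M_mono) simp
  ultimately show ?thesis
    unfolding D of_real_diff[symmetric] norm_of_real by (auto simp only: indicator_def split: if_splits) auto
qed

lemma Hp_norm_block_le:
  assumes "0 < p"
  shows "Hp_norm m p (mart_of m (vil_block a)) \<le> ennreal (real (vil_M m (a + 1)) / real (vil_M m a) powr (1 / p))"
proof -
  let ?M = "real (vil_M m (a + 1))" and ?I = "vil_cyl m a (\<lambda>_. 0)"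
  have "(\<integral>\<^sup>+x. enn_powr (mart_max (mart_of m (vil_block a)) x) p \<partial>vil_haar m) \<le>
      (\<integral>\<^sup>+x. ennreal (?M powr p) * indicator ?I x \<partial>vil_haar m)"
  proof (rule nn_integral_mono)
    fix x assume "x \<in> space (vil_haar m)"
    then have x: "x \<in> vil_points m" by (simp add: space_vil_haar)
    have "enn_powr (mart_max (mart_of m (vil_block a)) x) p \<le> enn_powr (ennreal (?M * indicator ?I x)) p"
      by (intro enn_powr_mono assms order_trans[OF mart_max_block_le] ennreal_leI norm_vil_block_le x)
    also have "\<dots> = ennreal (?M powr p) * indicator ?I x"
      by (simp add: enn_powr_ennreal indicator_def)
    finally show "enn_powr (mart_max (mart_of m (vil_block a)) x) p \<le> ennreal (?M powr p) * indicator ?I x" .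
  qed
  also have "\<dots> = ennreal (?M powr p * (1 / real (vil_M m a)))"
    using zero_in_vil_points vil_cyl_sets[OF zero_in_vil_points]
    by (subst nn_integral_cmult_indicator) (simp_all add: emeasure_vil_cyl[of m, OF m2] flip: ennreal_mult')
  finally have "Hp_norm m p (mart_of m (vil_block a)) \<le> enn_powr (ennreal (?M powr p * (1 / real (vil_M m a)))) (1 / p)"
    unfolding Hp_norm_def Lp_norm_def using assms by (intro enn_powr_mono) auto
  also have "\<dots> = ennreal (?M / real (vil_M m a) powr (1 / p))"
    using assms by (subst enn_powr_ennreal)
      (simp_all only: powr_mult powr_powr powr_divide powr_one_eq_one, simp_all)
  finally show ?thesis .
qed

text \<open>The function has modulus \<open>1 / c\<close> at every point. The weak norm uses a
  strict inequality, so the level is taken as half of this; it is exceeded on the whole space, of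
  measure one.\<close>

lemma weak_Lp_norm_block_ge:
  assumes "0 < c"
  shows "ennreal (1 / (2 * c)) \<le>
    weak_Lp_norm m p (\<lambda>x. vil_S m (vil_M m a + 1) (vil_block a) x / complex_of_real c)"
proof -
  interpret prob_space "vil_haar m" by (rule prob_space_vil_haar) (rule m2)
  have "{x \<in> vil_points m. 1 / (2 * c) < norm (vil_S m (vil_M m a + 1) (vil_block a) x / complex_of_real c)}
      = space (vil_haar m)"
    unfolding vil_S_block_Suc using assms by (auto simp: norm_divide space_vil_haar divide_strict_left_mono)
  then have "ennreal (1 / (2 * c)) = ennreal (1 / (2 * c) * measure (vil_haar m)
      {x \<in> vil_points m. 1 / (2 * c) < norm (vil_S m (vil_M m a + 1) (vil_block a) x / complex_of_real c)} powr (1 / p))"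
    by (simp only: prob_space powr_one_eq_one mult_1_right)
  also have "\<dots> \<le> weak_Lp_norm m p (\<lambda>x. vil_S m (vil_M m a + 1) (vil_block a) x / complex_of_real c)"
    unfolding weak_Lp_norm_def by (rule SUP_upper) (use assms in simp)
  finally show ?thesis .
qed

text \<open>In the constant, \<open>2\<close> comes from the halved level of the weak norm and
  \<open>B\<close> from \<open>M\<^sub>a\<^sub>+\<^sub>1 \<le> B M\<^sub>a\<close> in the Hardy
  norm.\<close>

lemma block_ratio_ge:
  assumes p: "0 < p" and c: "0 < c"
  shows "ennreal (real (vil_M m a) powr (1 / p - 1) / c / (2 * real B)) \<le>
    weak_Lp_norm m p (\<lambda>x. vil_S m (vil_M m a + 1) (vil_block a) x / complex_of_real c)
      / Hp_norm m p (mart_of m (vil_block a))"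
proof -
  let ?K = "real (vil_M m a)" and ?M = "real (vil_M m (a + 1))"
  have pos: "0 < ?K" "0 < ?M" by (simp_all only: of_nat_0_less_iff vil_M_positive)
  have M: "?M \<le> real B * ?K" using vil_M_Suc_le[of a] by (simp only: Suc_eq_plus1)
  have "?K powr (1 / p - 1) / c / (2 * real B) = ?K powr (1 / p) / (2 * c * (real B * ?K))"
    using pos by (simp only: powr_diff) simp
  also have "\<dots> \<le> ?K powr (1 / p) / (2 * c * ?M)"
    using pos c M B_ge_2 by (intro divide_left_mono mult_left_mono mult_pos_pos) auto
  also have "\<dots> = 1 / (2 * c) / (?M / ?K powr (1 / p))"
    using pos by (simp only: divide_divide_eq_left divide_divide_eq_right) simp
  finally have "ennreal (?K powr (1 / p - 1) / c / (2 * real B)) \<le> ennreal (1 / (2 * c) / (?M / ?K powr (1 / p)))"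
    by (rule ennreal_leI)
  also have "\<dots> = ennreal (1 / (2 * c)) / ennreal (?M / ?K powr (1 / p))"
  proof (rule divide_ennreal[symmetric])
    show "0 \<le> 1 / (2 * c)" using c by simp
    show "0 < ?M / ?K powr (1 / p)" using pos by (intro divide_pos_pos) auto
  qed
  also have "\<dots> \<le> weak_Lp_norm m p (\<lambda>x. vil_S m (vil_M m a + 1) (vil_block a) x / complex_of_real c)
      / Hp_norm m p (mart_of m (vil_block a))"
    unfolding divide_ennreal_def
    by (intro mult_mono weak_Lp_norm_block_ge[OF c] ennreal_inverse_antimono Hp_norm_block_le[OF p]) auto
  finally show ?thesis .
qed

text \<open>Bracketing \<open>n - 2\<close> and rounding the index down to an even one cost a factor
  \<open>B\<close> each. The lower bound on \<open>n\<close> makes the index at least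
  \<open>2\<close>, hence \<open>j\<close> positive.\<close>

lemma vil_M_even_bracket:
  assumes "vil_M m 2 + 2 \<le> n"
  obtains j where "0 < j" "vil_M m (2 * j) + 2 \<le> n" "real n \<le> 2 * real B ^ 2 * real (vil_M m (2 * j))"
proof -
  have "1 \<le> n - 2" using assms vil_M_positive[of 2] by linarith
  then obtain N where N: "vil_M m N \<le> n - 2" "n - 2 < vil_M m (Suc N)" by (rule vil_M_bracket)
  have "2 \<le> N"
  proof (rule ccontr)
    assume "\<not> 2 \<le> N"
    then have "vil_M m (Suc N) \<le> vil_M m 2" by (intro vil_M_mono) simp
    then show False using N(2) assms by linarith
  qed
  define j where "j = N div 2"
  have j: "0 < j" "2 * j \<le> N" "Suc N \<le> Suc (Suc (2 * j))" using \<open>2 \<le> N\<close> by (auto simp: j_def)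
  have "vil_M m (2 * j) \<le> n - 2" using vil_M_mono[OF j(2)] N(1) by (rule order_trans)
  then have 1: "vil_M m (2 * j) + 2 \<le> n" using assms by linarith
  have "n - 2 < vil_M m (Suc (Suc (2 * j)))" using N(2) vil_M_mono[OF j(3)] by (rule less_le_trans)
  moreover have "1 \<le> vil_M m (Suc (Suc (2 * j)))" using vil_M_positive by (simp only: Suc_le_eq One_nat_def)
  \<comment> \<open>The factor \<open>2\<close> absorbs the shift: \<open>n\<close> exceeds the
    bracketing value by at most \<open>1\<close>.\<close>
  ultimately have "n \<le> 2 * vil_M m (Suc (Suc (2 * j)))" by linarith
  then have "real n \<le> 2 * real (vil_M m (Suc (Suc (2 * j))))"
    by (metis of_nat_le_iff of_nat_mult of_nat_numeral)
  also have "\<dots> \<le> 2 * (real B * (real B * real (vil_M m (2 * j))))"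
    by (intro mult_left_mono order_trans[OF vil_M_Suc_le] vil_M_Suc_le) auto
  finally show ?thesis using that[OF j(1) 1] by (simp only: power2_eq_square ac_simps)
qed

text \<open>Moves from a good \<open>n\<close> given by the limsup to
  \<open>K = vil_M m (2 * j)\<close> with \<open>K + 2 \<le> n\<close>: the numerator drops by at
  most a constant factor, and monotonicity of \<open>\<Phi>\<close> makes the denominator no
  larger.\<close>

lemma frequently_block_large:
  fixes \<Phi> :: "nat \<Rightarrow> real"
  assumes p: "0 < p" "p < 1" and pos: "\<And>n. 0 < \<Phi> n" and mono: "mono \<Phi>"
    and limsup: "limsup (\<lambda>n. ereal (real n powr (1 / p - 1) / \<Phi> n)) = \<infinity>"
  obtains j where "0 < j" "R \<le> real (vil_M m (2 * j)) powr (1 / p - 1) / \<Phi> (vil_M m (2 * j) + 2)"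
proof -
  define q where "q = 1 / p - 1"
  have q: "0 < q" using p by (simp add: q_def)
  \<comment> \<open>The loss in the numerator: \<open>n \<le> 2 * B ^ 2 * K\<close> raised to the
    power \<open>q\<close>.\<close>
  define c where "c = (2 * real B ^ 2) powr q"
  have c: "0 < c" using B_ge_2 by (simp add: c_def)
  have "\<exists>n \<ge> vil_M m 2 + 2. c * R \<le> real n powr q / \<Phi> n"
  proof (rule ccontr)
    assume "\<not> ?thesis"
    then have "\<forall>n \<ge> vil_M m 2 + 2. ereal (real n powr q / \<Phi> n) \<le> ereal (c * R)"
      by (auto simp only: not_le ereal_less_eq intro: less_imp_le)
    then have "limsup (\<lambda>n. ereal (real n powr q / \<Phi> n)) \<le> ereal (c * R)"
      by (intro Limsup_bounded eventually_sequentiallyI[of "vil_M m 2 + 2"]) blast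
    then show False using limsup by (simp add: q_def)
  qed
  then obtain n where n: "vil_M m 2 + 2 \<le> n" "c * R \<le> real n powr q / \<Phi> n" by blast
  obtain j where j: "0 < j" "vil_M m (2 * j) + 2 \<le> n" "real n \<le> 2 * real B ^ 2 * real (vil_M m (2 * j))"
    using vil_M_even_bracket[OF n(1)] .
  let ?K = "real (vil_M m (2 * j))"
  have "real n powr q \<le> (2 * real B ^ 2 * ?K) powr q" using q j(3) by (intro powr_mono2) auto
  also have "\<dots> = c * ?K powr q" by (simp add: c_def powr_mult)
  finally have "real n powr q / \<Phi> n \<le> c * ?K powr q / \<Phi> (vil_M m (2 * j) + 2)"
    using pos monoD[OF mono j(2)] c by (intro frac_le) auto
  with n(2) have "c * R \<le> c * (?K powr q / \<Phi> (vil_M m (2 * j) + 2))" by (simp only: times_divide_eq_right)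
  then have "R \<le> ?K powr q / \<Phi> (vil_M m (2 * j) + 2)" using c by (rule mult_left_le_imp_le)
  then show ?thesis using that[OF j(1)] by (simp only: q_def)
qed

lemma block_ratio_unbounded:
  fixes \<Phi> :: "nat \<Rightarrow> real"
  assumes p: "0 < p" "p < 1" and \<Phi>: "\<And>n. 0 < \<Phi> n" "mono \<Phi>"
    and limsup: "limsup (\<lambda>n. ereal (real n powr (1 / p - 1) / \<Phi> n)) = \<infinity>"
  shows "\<exists>n :: nat \<Rightarrow> nat. (\<forall>k. 0 < n k) \<and>
    (SUP k. weak_Lp_norm m p (\<lambda>x. vil_S m (vil_M m (2 * n k) + 1) (vil_block (2 * n k)) x
        / complex_of_real (\<Phi> (vil_M m (2 * n k) + 2)))
      / Hp_norm m p (mart_of m (vil_block (2 * n k)))) = \<infinity>"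
proof -
  \<comment> \<open>The threshold \<open>2 * B * k\<close> cancels the constant of
    \<open>block_ratio_ge\<close>, so the \<open>k\<close>-th ratio is at least
    \<open>k\<close>.\<close>
  have "\<exists>j>0. 2 * real B * real k \<le> real (vil_M m (2 * j)) powr (1 / p - 1) / \<Phi> (vil_M m (2 * j) + 2)" for k
    using frequently_block_large[OF p \<Phi> limsup] by metis
  then obtain n where n: "\<And>k. 0 < n k"
    "\<And>k. 2 * real B * real k \<le> real (vil_M m (2 * n k)) powr (1 / p - 1) / \<Phi> (vil_M m (2 * n k) + 2)"
    by metis
  let ?r = "\<lambda>k. weak_Lp_norm m p (\<lambda>x. vil_S m (vil_M m (2 * n k) + 1) (vil_block (2 * n k)) x
        / complex_of_real (\<Phi> (vil_M m (2 * n k) + 2)))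
      / Hp_norm m p (mart_of m (vil_block (2 * n k)))"
  have "of_nat k \<le> ?r k" for k
  proof -
    have "0 < 2 * real B" using B_ge_2 by simp
    moreover have "real k * (2 * real B) \<le> real (vil_M m (2 * n k)) powr (1 / p - 1) / \<Phi> (vil_M m (2 * n k) + 2)"
      using n(2)[of k] by (simp only: mult.commute)
    ultimately have "real k \<le> real (vil_M m (2 * n k)) powr (1 / p - 1) / \<Phi> (vil_M m (2 * n k) + 2) / (2 * real B)"
      by (simp only: pos_le_divide_eq)
    then have "ennreal (real k) \<le> ?r k"
      by (rule order_trans[OF ennreal_leI block_ratio_ge[OF p(1) \<Phi>(1)]])
    then show ?thesis by (simp only: ennreal_of_nat_eq_real_of_nat)
  qed
  then have "(SUP k. of_nat k) \<le> (SUP k. ?r k)" by (intro SUP_mono) blast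
  then have "(SUP k. ?r k) = \<infinity>"
    by (simp only: ennreal_SUP_of_nat_eq_top top_unique infinity_ennreal_def)
  with n(1) have "(\<forall>k. 0 < n k) \<and> (SUP k. ?r k) = \<infinity>" by (intro conjI allI)
  then show ?thesis by (rule exI[of _ n])
qed

end

theorem theorem2p4:
  fixes m :: "nat \<Rightarrow> nat" and p :: real
  assumes "\<And>k. 2 \<le> m k" and "bdd_above (range m)"
    and "0 < p" and "p < 1"
  shows "bounded_Hp_Lp m p (weighted_max_S m p) \<and>
    (\<forall>\<Phi> :: nat \<Rightarrow> real.
       (\<forall>n. 0 < \<Phi> n) \<and> mono \<Phi> \<and>
       limsup (\<lambda>n. ereal (real n powr (1 / p - 1) / \<Phi> n)) = \<infinity> \<longrightarrow>
       (\<exists>n :: nat \<Rightarrow> nat. (\<forall>k. 0 < n k) \<and>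
          (let f = (\<lambda>k x. vil_D m (vil_M m (2 * n k + 1)) x - vil_D m (vil_M m (2 * n k)) x)
           in (SUP k. weak_Lp_norm m p
                        (\<lambda>x. vil_S m (vil_M m (2 * n k) + 1) (f k) x
                               / complex_of_real (\<Phi> (vil_M m (2 * n k) + 2)))
                      / Hp_norm m p (mart_of m (f k))) = \<infinity>)))"
proof -
  obtain B where "\<And>k. m k \<le> B" using assms(2) by (auto simp: bdd_above_def)
  with assms(1) interpret bounded_vilenkin m B by unfold_locales
  show ?thesis
    unfolding Let_def
  proof (intro conjI allI impI)
    show "bounded_Hp_Lp m p (weighted_max_S m p)"
      by (rule bounded_weighted_max_S[OF assms(3,4)])
  next
    fix \<Phi> :: "nat \<Rightarrow> real"
    assume "(\<forall>n. 0 < \<Phi> n) \<and> mono \<Phi> \<and> limsup (\<lambda>n. ereal (real n powr (1 / p - 1) / \<Phi> n)) = \<infinity>"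
    then have \<Phi>: "\<And>n. 0 < \<Phi> n" "mono \<Phi>"
      "limsup (\<lambda>n. ereal (real n powr (1 / p - 1) / \<Phi> n)) = \<infinity>" by blast+
    show "\<exists>n :: nat \<Rightarrow> nat. (\<forall>k. 0 < n k) \<and>
      (SUP k. weak_Lp_norm m p
          (\<lambda>x. vil_S m (vil_M m (2 * n k) + 1)
            (\<lambda>x. vil_D m (vil_M m (2 * n k + 1)) x - vil_D m (vil_M m (2 * n k)) x) x
            / complex_of_real (\<Phi> (vil_M m (2 * n k) + 2)))
        / Hp_norm m p (mart_of m (\<lambda>x. vil_D m (vil_M m (2 * n k + 1)) x - vil_D m (vil_M m (2 * n k)) x))) = \<infinity>"
      by (rule block_ratio_unbounded[OF assms(3,4) \<Phi>])
  qed
qed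

end
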